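(* Let $0<p<\infty$, let $\phi$ be a holomorphic self map of the open unit disk $\mathbb{D}$ and let $B$ be an arbitrary Blaschke product. Let $\mathcal{L}_{B,\phi}$ be the set of all inner functions $\theta$ such that $C_\phi(\theta H^p)\subseteq BH^p$. Then $\mathcal{L}_{B,\phi}$ is exactly the set of all products $B_1S$ where $S$ is a singular inner function and $B_1$ is a Blaschke product such that $\mathrm{mult}_B(w)\le \mathrm{mult}_{B_1\circ\phi}(w)$ for all $w\in Z(B)$.
   Context: For $0<p<\infty$, $H^p$ is the Hardy space on the open unit disk $\mathbb{D}$, $\theta H^p=\{\theta f:f\in H^p\}$, and $C_\phi(f)=f\circ\phi$. An inner function is a bounded holomorphic function on $\mathbb{D}$ whose radial limits have modulus $1$ a.e. on the unit circle $\mathbb{T}$. A Blaschke product is a function $B(z)=\gamma z^m\prod_i\frac{|a_i|}{a_i}\frac{a_i-z}{1-\overline{a_i}z}$ with $\gamma\in\mathbb{T}$, $m\in\mathbb{N}\cup\{0\}$, and $\{a_i\}\subseteq\mathbb{D}\setminus\{0\}$ a (possibly finite or empty) sequence with $\sum_i(1-|a_i|)<\infty$; unimodular constants are included. A singular inner function is a non-vanishing inner function (unimodular constants are included). $Z(f)$ is the set of zeros of $f$ in $\mathbb{D}$ and $\mathrm{mult}_f(w)$ is the order of vanishing of $f$ at $w$, equal to $0$ if $f(w)\neq0$ and to $\infty$ if $f\equiv0$. *)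

theory Defs
  imports "HOL-Complex_Analysis.Complex_Analysis" "HOL-Library.Extended_Nat"
begin

text \<open>
  Functions on the open unit disk are represented by total functions on the complex plane of
  which only the values on the disk matter. All predicates and sets of functions below are
  invariant under changing a function outside the disk, so that inclusions and equalities between
  them express the corresponding relations between sets of functions on the disk.
\<close>

abbreviation unit_disk :: "complex set" where
  "unit_disk \<equiv> ball 0 1"

definition hardy_space :: "real \<Rightarrow> (complex \<Rightarrow> complex) set" where
  "hardy_space p = {f. f holomorphic_on unit_disk \<and>
     bdd_above ((\<lambda>r. 1 / (2 * pi) * integral {0..2 * pi} (\<lambda>t. cmod (f (of_real r * cis t)) powr p))
       ` {0<..<1})}"

definition mult_space ::
    "(complex \<Rightarrow> complex) \<Rightarrow> (complex \<Rightarrow> complex) set \<Rightarrow> (complex \<Rightarrow> complex) set" where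
  "mult_space \<theta> H = {g. \<exists>f\<in>H. \<forall>z\<in>unit_disk. g z = \<theta> z * f z}"

definition comp_op :: "(complex \<Rightarrow> complex) \<Rightarrow> (complex \<Rightarrow> complex) \<Rightarrow> complex \<Rightarrow> complex" where
  "comp_op \<phi> f = f \<circ> \<phi>"

definition inner_function :: "(complex \<Rightarrow> complex) \<Rightarrow> bool" where
  "inner_function \<theta> \<longleftrightarrow>
     \<theta> holomorphic_on unit_disk \<and> bounded (\<theta> ` unit_disk) \<and>
     (AE t in lebesgue_on {0..2 * pi}.
        \<exists>l. ((\<lambda>r. \<theta> (of_real r * cis t)) \<longlongrightarrow> l) (at_left 1) \<and> cmod l = 1)"

definition singular_inner :: "(complex \<Rightarrow> complex) \<Rightarrow> bool" where
  "singular_inner S \<longleftrightarrow> inner_function S \<and> (\<forall>z\<in>unit_disk. S z \<noteq> 0)"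

definition blaschke_factor :: "complex \<Rightarrow> complex \<Rightarrow> complex" where
  "blaschke_factor a z = of_real (cmod a) / a * ((a - z) / (1 - cnj a * z))"

text \<open>
  The extended natural number \<open>N\<close> is the length of the sequence of zeros \<open>a\<close>: it is \<open>0\<close> for the
  empty sequence and \<open>\<infinity>\<close> for an infinite one. Entries \<open>a i\<close> with \<open>i \<ge> N\<close> are ignored.
\<close>

definition blaschke_product :: "(complex \<Rightarrow> complex) \<Rightarrow> bool" where
  "blaschke_product B \<longleftrightarrow> (\<exists>(\<gamma>::complex) (m::nat) (N::enat) (a::nat \<Rightarrow> complex).
     cmod \<gamma> = 1 \<and>
     (\<forall>i. enat i < N \<longrightarrow> a i \<in> unit_disk - {0}) \<and>
     summable (\<lambda>i. if enat i < N then 1 - cmod (a i) else 0) \<and>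
     (\<forall>z\<in>unit_disk.
        B z = \<gamma> * z ^ m * (\<Prod>i. if enat i < N then blaschke_factor (a i) z else 1)))"

definition zero_set :: "(complex \<Rightarrow> complex) \<Rightarrow> complex set" where
  "zero_set f = {z \<in> unit_disk. f z = 0}"

definition vanishing_mult :: "(complex \<Rightarrow> complex) \<Rightarrow> complex \<Rightarrow> enat" where
  "vanishing_mult f w =
     (if f w \<noteq> 0 then 0
      else if \<forall>z\<in>unit_disk. f z = 0 then \<infinity>
      else enat (nat (zorder f w)))"

definition inner_comp_class ::
    "real \<Rightarrow> (complex \<Rightarrow> complex) \<Rightarrow> (complex \<Rightarrow> complex) \<Rightarrow> (complex \<Rightarrow> complex) set" where
  "inner_comp_class p B \<phi> = {\<theta>. inner_function \<theta> \<and>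
     comp_op \<phi> ` mult_space \<theta> (hardy_space p) \<subseteq> mult_space B (hardy_space p)}"

end

theory Submission
  imports Defs
begin

text \<open>
  Multiplicities enter through division: since the Blaschke product \<open>B\<close> is holomorphic and not
  identically zero on the disk, the condition on the zeros of \<open>B\<close> says exactly that
  \<open>B1 \<circ> \<phi> = B * k\<close> for some holomorphic \<open>k\<close> (\<open>vanishing_mult_le_of_factor\<close>,
  \<open>factor_of_vanishing_mult_le\<close>).

  If \<open>\<theta>\<close> belongs to the class, write \<open>\<theta> = B1 * S\<close> with \<open>B1\<close> a Blaschke product and \<open>S\<close> singular
  inner (\<open>inner_function_factorization\<close>). Testing the inclusion on \<open>f = 1\<close> gives \<open>\<theta> \<circ> \<phi> = B * g\<close>,
  and since \<open>S \<circ> \<phi>\<close> has no zeros, \<open>B1 \<circ> \<phi>\<close> is \<open>B\<close> times the holomorphic function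
  \<open>g / (S \<circ> \<phi>)\<close>. Conversely, if \<open>B1 \<circ> \<phi> = B * k\<close>, then for \<open>f\<close> in the Hardy space
  \<open>(\<theta> * f) \<circ> \<phi> = B * (k * ((S * f) \<circ> \<phi>))\<close>. The left-hand side lies in the Hardy space by
  Littlewood's subordination principle (\<open>hardy_space_comp\<close>), and dividing a Hardy space function
  by a Blaschke product, as soon as the quotient is holomorphic, stays in the Hardy space
  (\<open>hardy_space_divide_blaschke\<close>). The product \<open>B1 * S\<close> is inner because Blaschke products are
  (\<open>blaschke_product_inner\<close>).

  All facts about means of \<open>|f| ^ p\<close> rest on one inequality: \<open>|f| ^ p\<close> is bounded by the Poisson
  integral of its boundary values (\<open>norm_powr_le_poisson\<close>). It is clear when \<open>f\<close> has no zeros, for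
  then \<open>|f| ^ p\<close> is the modulus of a holomorphic function, and a zero can be moved out of the disk
  so that \<open>|f|\<close> stays the same on the circle and does not decrease inside. Integrating the inequality
  along a holomorphic map gives subordination and the monotonicity of the means. Division by \<open>B\<close> then
  follows because finite Blaschke products have modulus close to 1 near the circle, so that
  dividing by them does not increase the supremum of the means, and the tails of the infinite
  product tend to 1 pointwise while being bounded by 1.

  The existence of radial limits is the analytic core. Fatou's theorem is replaced by an argument
  special to Blaschke products. Write \<open>B = P n * T n\<close> with \<open>P n\<close> a finite product, continuous up to
  the circle, and \<open>T n\<close> the tail. From \<open>|T n| \<le> 1\<close> one gets \<open>|1 - T n|\<^sup>2 \<le> 2 * Re (1 - T n)\<close>,
  where \<open>Re (1 - T n)\<close> is a nonnegative harmonic function whose value at 0 tends to 0. A weak type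
  inequality for the radial maximal function of such functions (\<open>radial_maximal_inequality\<close>) shows
  that \<open>T n\<close> is uniformly close to 1 along all radii outside a set of small measure. Hence for
  almost every radius \<open>B\<close> is a uniform limit of functions that have unimodular limits.

  The factorization of an inner function follows: finite Blaschke products built from its zeros can
  be divided out without increasing the bound, and evaluation at 0 turns this into the Blaschke
  condition. The zero-free quotient inherits its radial limits from those of the inner function and
  of the Blaschke product.
\<close>

section \<open>The Poisson formula\<close>

lemma Cauchy_formula_unit_circle:
  assumes "f holomorphic_on ball 0 R" "1 < R" "norm w < 1"
  shows "((\<lambda>t. f (cis t) * (cis t / (cis t - w))) has_integral of_real (2 * pi) * f w) {0..2 * pi}"
proof -
  have "((\<lambda>u. f u / (u - w)) has_contour_integral (2 * of_real pi * \<i> * f w)) (circlepath 0 1)"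
    by (rule Cauchy_integral_circlepath_simple)
       (use assms in \<open>auto intro: holomorphic_on_subset\<close>)
  then have "((\<lambda>t. f (0 + of_real 1 * cis t) / (0 + of_real 1 * cis t - w) * of_real 1 * \<i> * cis t)
      has_integral (2 * of_real pi * \<i> * f w)) {0..2*pi}"
    unfolding circlepath_def by (subst (asm) has_contour_integral_part_circlepath_iff) auto
  from has_integral_mult_right[OF this, of "-\<i>"] show ?thesis
    by (simp add: field_simps)
qed

definition poisson_kernel :: "complex \<Rightarrow> real \<Rightarrow> real" where
  "poisson_kernel z t = (1 - (norm z)\<^sup>2) / (norm (cis t - z))\<^sup>2"

lemma cis_neq: "norm z < 1 \<Longrightarrow> cis t \<noteq> z"
  by (metis norm_cis less_irrefl)

lemma poisson_kernel_nonneg: "norm z < 1 \<Longrightarrow> 0 \<le> poisson_kernel z t"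
  by (simp add: poisson_kernel_def power_le_one)

text \<open>
  Exhibits the kernel as a harmonic function of \<open>z\<close>, so that the mean value property can be
  applied to it after composition with a holomorphic map.
\<close>
lemma poisson_kernel_eq_Re:
  "poisson_kernel z t = Re ((cis t + z) / (cis t - z))"
proof -
  have "(cis t + z) / (cis t - z) = (cis t + z) * cnj (cis t - z) / (norm (cis t - z))\<^sup>2"
    by (metis complex_div_cnj complex_norm_square of_real_power)
  also have "Re \<dots> = Re ((cis t + z) * cnj (cis t - z)) / (norm (cis t - z))\<^sup>2"
    by (metis Re_divide_of_real of_real_power)
  also have "Re ((cis t + z) * cnj (cis t - z)) = ((cos t)\<^sup>2 + (sin t)\<^sup>2) - (norm z)\<^sup>2"
    unfolding cmod_power2 by (simp add: algebra_simps power2_eq_square)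
  finally show ?thesis by (simp add: poisson_kernel_def)
qed

lemma Poisson_formula:
  assumes "f holomorphic_on ball 0 R" "1 < R" "norm w < 1"
  shows "((\<lambda>t. of_real (poisson_kernel w t) * f (cis t)) has_integral of_real (2 * pi) * f w) {0..2 * pi}"
proof -
  \<comment> \<open>The function \<open>1 - cnj w * z\<close> has no zeros in the disk of this radius.\<close>
  obtain R' where R': "1 < R'" "R' \<le> R" "norm w * R' < 1"
  proof (cases "w = 0")
    case True
    then show ?thesis using that[of R] assms by auto
  next
    case False
    define R' where "R' = min R ((1 + 1 / norm w) / 2)"
    have "norm w * R' \<le> norm w * ((1 + 1 / norm w) / 2)"
      unfolding R'_def by (rule mult_left_mono[OF min.cobounded2]) auto
    also have "\<dots> = (norm w + 1) / 2" using False by (simp add: field_simps)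
    finally have "norm w * R' < 1" using assms by auto
    moreover have "1 < R'" using False assms by (auto simp: R'_def field_simps)
    ultimately show ?thesis using that[of R'] by (auto simp: R'_def)
  qed
  \<comment> \<open>The extra factor is 1 at \<open>w\<close> and turns the Cauchy kernel on the circle into the Poisson kernel.\<close>
  define g where "g z = f z * ((1 - (norm w)\<^sup>2) / (1 - cnj w * z))" for z
  have nz: "1 - cnj w * z \<noteq> 0" if "z \<in> ball 0 R'" for z
  proof -
    have "norm (cnj w * z) \<le> norm w * R'" using that by (simp add: norm_mult mult_left_mono)
    then show ?thesis using R'(3) by (metis norm_one eq_iff_diff_eq_0 less_le_not_le order.trans)
  qed
  have "g holomorphic_on ball 0 R'"
    unfolding g_def using nz R' by (auto intro!: holomorphic_intros holomorphic_on_subset[OF assms(1)])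
  from Cauchy_formula_unit_circle[OF this R'(1) assms(3)]
  have *: "((\<lambda>t. g (cis t) * (cis t / (cis t - w))) has_integral of_real (2 * pi) * g w) {0..2 * pi}" .
  have 1: "g w = f w"
  proof -
    have "1 - cnj w * w = of_real (1 - (norm w)\<^sup>2)"
      by (simp add: complex_norm_square mult.commute del: of_real_power)
    moreover have "1 - (norm w)\<^sup>2 \<noteq> 0"
      using assms(3) by (metis abs_square_less_1 abs_norm_cancel eq_iff_diff_eq_0 less_irrefl)
    ultimately show ?thesis unfolding g_def
      by (metis mult.right_neutral of_real_diff of_real_1 of_real_power of_real_eq_0_iff divide_self)
  qed
  have 2: "g (cis t) * (cis t / (cis t - w)) = of_real (poisson_kernel w t) * f (cis t)" for t
  proof -
    have "cis t / (1 - cnj w * cis t) = 1 / cnj (cis t - w)"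
    proof -
      have "1 - cnj w * cis t = cis t * cnj (cis t - w)"
        by (simp add: algebra_simps cis_cnj cis_mult)
      then show ?thesis by simp
    qed
    have "g (cis t) * (cis t / (cis t - w))
        = f (cis t) * (1 - (norm w)\<^sup>2) * (cis t / (1 - cnj w * cis t)) / (cis t - w)"
      unfolding g_def by simp
    also have "\<dots> = f (cis t) * (1 - (norm w)\<^sup>2) / (cnj (cis t - w) * (cis t - w))"
      unfolding \<open>cis t / (1 - cnj w * cis t) = 1 / cnj (cis t - w)\<close> by simp
    also have "cnj (cis t - w) * (cis t - w) = of_real ((norm (cis t - w))\<^sup>2)"
      by (simp add: complex_norm_square mult.commute del: of_real_power)
    finally show ?thesis by (simp add: poisson_kernel_def)
  qed
  show ?thesis using * unfolding 1 2 .
qed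

lemma continuous_on_poisson_kernel:
  assumes "continuous_on A f" "continuous_on A g" "\<And>x. x \<in> A \<Longrightarrow> norm (f x) < 1"
  shows "continuous_on A (\<lambda>x. poisson_kernel (f x) (g x))"
proof -
  have "cis (g x) \<noteq> f x" if "x \<in> A" for x using cis_neq assms(3) that by blast
  then show ?thesis unfolding poisson_kernel_def
    by (auto intro!: continuous_intros assms)
qed

section \<open>Division and orders of vanishing\<close>

text \<open>
  Near each point both functions are a power of \<open>z - w\<close> times a zero-free function, so the quotient
  has removable singularities only. The last conclusion serves to produce zero-free quotients.
\<close>
lemma holomorphic_divide_zorder:
  assumes A: "open A" "connected A" and h: "h holomorphic_on A" "\<exists>z\<in>A. h z \<noteq> 0"
    and b: "b holomorphic_on A" "\<exists>z\<in>A. b z \<noteq> 0"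
    and le: "\<And>w. w \<in> A \<Longrightarrow> b w = 0 \<Longrightarrow> zorder b w \<le> zorder h w"
  obtains q where "q holomorphic_on A" "\<And>z. z \<in> A \<Longrightarrow> h z = b z * q z"
    "\<And>w. w \<in> A \<Longrightarrow> zorder h w = zorder b w \<Longrightarrow> q w \<noteq> 0"
proof -
  define q where "q z = (if b z = 0 then Lim (at z) (\<lambda>u. h u / b u) else h z / b z)" for z
  have "\<exists>r>0. \<exists>k. ball w r \<subseteq> A \<and> k holomorphic_on ball w r \<and> (\<forall>z\<in>ball w r. q z = k z \<and> h z = b z * k z) \<and>
          (zorder h w = zorder b w \<longrightarrow> k w \<noteq> 0)"
    if w: "w \<in> A" for w
  proof -
    define n m gh gb where "n = zorder h w" "m = zorder b w" "gh = zor_poly h w" "gb = zor_poly b w"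
    note defs = this
    obtain r1 where r1: "if h w = 0 then n > 0 else n = 0" "r1 > 0" "cball w r1 \<subseteq> A" "gh holomorphic_on cball w r1"
      "\<And>z. z \<in> cball w r1 \<Longrightarrow> h z = gh z * (z - w) ^ nat n \<and> gh z \<noteq> 0"
      using zorder_exist_zero[OF h(1) A w h(2)] unfolding defs by blast
    obtain r2 where r2: "if b w = 0 then m > 0 else m = 0" "r2 > 0" "cball w r2 \<subseteq> A" "gb holomorphic_on cball w r2"
      "\<And>z. z \<in> cball w r2 \<Longrightarrow> b z = gb z * (z - w) ^ nat m \<and> gb z \<noteq> 0"
      using zorder_exist_zero[OF b(1) A w b(2)] unfolding defs by blast
    have mn: "0 \<le> m" "0 \<le> n" "m \<le> n"
      using le[OF w] r1(1) r2(1) by (auto simp: defs split: if_splits)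
    define r where "r = min r1 r2"
    define k where "k z = gh z / gb z * (z - w) ^ (nat n - nat m)" for z
    have sub: "ball w r \<subseteq> cball w r1" "ball w r \<subseteq> cball w r2" "r > 0"
      using r1 r2 by (auto simp: r_def)
    have "gh holomorphic_on ball w r" "gb holomorphic_on ball w r" "\<And>z. z \<in> ball w r \<Longrightarrow> gb z \<noteq> 0"
      using holomorphic_on_subset[OF r1(4) sub(1)] holomorphic_on_subset[OF r2(4) sub(2)] r2(5) sub(2) by auto
    then have k: "k holomorphic_on ball w r" unfolding k_def
      by (intro holomorphic_intros)
    have hk: "h z = b z * k z" if "z \<in> ball w r" for z
    proof -
      have "z \<in> cball w r1" "z \<in> cball w r2" using that sub by auto
      then have "h z = gh z * (z - w) ^ nat n" "b z = gb z * (z - w) ^ nat m" "gb z \<noteq> 0"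
        using r1(5) r2(5) by auto
      moreover have "nat n = nat m + (nat n - nat m)" using mn by auto
      ultimately show ?thesis unfolding k_def
        by (simp add: power_add[symmetric])
    qed
    have bnz: "b z \<noteq> 0" if "z \<in> ball w r" "z \<noteq> w" for z
      using r2(5)[of z] that sub by auto
    have qk: "q z = k z" if "z \<in> ball w r" for z
    proof (cases "b z = 0")
      case False
      then show ?thesis using hk[OF that] by (simp add: q_def)
    next
      case True
      then have [simp]: "z = w" using bnz that by auto
      have "(k \<longlongrightarrow> k w) (at w)"
        using k sub(3) by (metis centre_in_ball holomorphic_on_imp_continuous_on continuous_on_def at_within_open open_ball)
      moreover have "\<forall>\<^sub>F u in at w. k u = h u / b u"
        using eventually_at_ball'[OF sub(3), of w UNIV]
        by eventually_elim (use bnz hk in \<open>auto simp: dist_commute\<close>)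
      ultimately have "((\<lambda>u. h u / b u) \<longlongrightarrow> k w) (at w)"
        using tendsto_cong by fastforce
      then have "Lim (at w) (\<lambda>u. h u / b u) = k w" by (intro tendsto_Lim) auto
      then show ?thesis using True by (simp add: q_def)
    qed
    have "k w \<noteq> 0" if "zorder h w = zorder b w"
      using that r1(5)[of w] r2(5)[of w] r1(2) r2(2) by (auto simp: k_def defs)
    moreover have "ball w r \<subseteq> A" using sub(1) r1(3) by (rule subset_trans)
    ultimately show ?thesis using sub(3) k hk qk by (intro exI[of _ r] exI[of _ k] conjI ballI impI) auto
  qed
  note * = this
  have "q analytic_on A" unfolding analytic_on_def
  proof
    fix w assume "w \<in> A"
    from *[OF this] obtain r k where "r > 0" "k holomorphic_on ball w r" "\<forall>z\<in>ball w r. q z = k z"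
      by blast
    then show "\<exists>e>0. q holomorphic_on ball w e"
      using holomorphic_transform[of k "ball w r" q] by metis
  qed
  moreover have "h w = b w * q w" "zorder h w = zorder b w \<Longrightarrow> q w \<noteq> 0" if w: "w \<in> A" for w
  proof -
    from *[OF w] obtain r k where r: "r > 0" "\<forall>z\<in>ball w r. q z = k z \<and> h z = b z * k z"
      "zorder h w = zorder b w \<longrightarrow> k w \<noteq> 0" by blast
    then have "w \<in> ball w r" by simp
    then have "q w = k w" "h w = b w * k w" using r(2) by blast+
    then show "h w = b w * q w" "zorder h w = zorder b w \<Longrightarrow> q w \<noteq> 0" using r(3) by simp_all
  qed
  ultimately show ?thesis using that analytic_imp_holomorphic by blast
qed

text \<open>
  Shows that a Blaschke factor has modulus at most 1 in the disk and exactly 1 on the circle.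
\<close>
lemma moebius_norm_identity:
  "(norm (1 - cnj a * z))\<^sup>2 - (norm (z - a))\<^sup>2 = (1 - (norm a)\<^sup>2) * (1 - (norm z)\<^sup>2)"
  unfolding cmod_power2 by (simp add: power2_eq_square algebra_simps)

lemma moebius_norm_le:
  assumes "norm a \<le> 1" "norm z \<le> 1"
  shows "norm (z - a) \<le> norm (1 - cnj a * z)"
proof -
  have "0 \<le> (1 - (norm a)\<^sup>2) * (1 - (norm z)\<^sup>2)"
    using assms by (intro mult_nonneg_nonneg) (auto simp: power_le_one)
  then have "(norm (z - a))\<^sup>2 \<le> (norm (1 - cnj a * z))\<^sup>2"
    using moebius_norm_identity[of a z] by linarith
  then show ?thesis by (rule power2_le_imp_le) simp
qed

lemma moebius_norm_eq: "norm z = 1 \<Longrightarrow> norm (z - a) = norm (1 - cnj a * z)"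
  using moebius_norm_identity[of a z] by simp

lemma moebius_denominator_nonzero:
  assumes "norm a < 1" "norm z \<le> 1"
  shows "1 - cnj a * z \<noteq> 0"
proof -
  have "norm (cnj a * z) \<le> norm a"
    using mult_left_mono[OF assms(2), of "norm a"] by (simp add: norm_mult)
  then have "cnj a * z \<noteq> 1" using assms(1) by auto
  then show ?thesis by auto
qed

lemma zorder_power_diff: "zorder (\<lambda>z. (z - a) ^ n) a = int n"
  by (rule zorder_eqI[of UNIV _ "\<lambda>_. 1"]) auto

lemma cball_enlarge_in_open:
  fixes U :: "complex set"
  assumes "open U" "cball 0 r \<subseteq> U" "0 \<le> r"
  obtains r' where "r < r'" "ball 0 r' \<subseteq> U"
proof -
  obtain e where e: "e > 0" "(\<Union>x\<in>cball 0 r. ball x e) \<subseteq> U"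
    using compact_subset_open_imp_ball_epsilon_subset[OF compact_cball assms(1,2)] by metis
  have "ball 0 (r + e) \<subseteq> (\<Union>x\<in>cball (0::complex) r. ball x e)"
  proof
    fix z :: complex assume z: "z \<in> ball 0 (r + e)"
    show "z \<in> (\<Union>x\<in>cball (0::complex) r. ball x e)"
    proof (cases "norm z \<le> r")
      case True
      then show ?thesis using e(1) by (intro UN_I[of z]) auto
    next
      case False
      then have nz: "z \<noteq> 0" using assms(3) by auto
      have "of_real (norm z) * sgn z = z" using nz by (auto simp: sgn_eq)
      then have "z - of_real r * sgn z = of_real (norm z - r) * sgn z"
        by (simp add: algebra_simps)
      then have "norm (z - of_real r * sgn z) < e" using z False nz
        by (simp only: norm_mult norm_of_real) (simp add: norm_sgn)
      then show ?thesis using assms(3)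
        by (intro UN_I[of "of_real r * sgn z"]) (auto simp: norm_mult norm_sgn dist_norm norm_minus_commute)
    qed
  qed
  then show ?thesis using that[of "r + e"] e by auto
qed

section \<open>Subharmonicity and subordination\<close>

text \<open>
  Without zeros, \<open>f = exp g\<close>, and \<open>|f| ^ p\<close> is the modulus of the holomorphic function
  \<open>exp (p * g)\<close>, to which the Poisson formula applies.
\<close>
lemma norm_powr_le_poisson_nonzero:
  assumes "f holomorphic_on ball 0 R" "1 < R" "norm w < 1" "\<And>z. z \<in> ball 0 R \<Longrightarrow> f z \<noteq> 0"
  shows "2 * pi * norm (f w) powr p \<le> integral {0..2 * pi} (\<lambda>t. poisson_kernel w t * norm (f (cis t)) powr p)"
proof -
  obtain g where g: "g holomorphic_on ball 0 R" "\<And>z. z \<in> ball 0 R \<Longrightarrow> f z = exp (g z)"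
    using contractible_imp_holomorphic_log[OF assms(1) _ assms(4)] convex_imp_contractible
    by (metis convex_ball)
  define k where "k z = exp (of_real p * g z)" for z
  have k: "norm (k z) = norm (f z) powr p" if "z \<in> ball 0 R" for z
    using g(2)[OF that] by (simp add: k_def powr_def)
  have "k holomorphic_on ball 0 R" unfolding k_def by (intro holomorphic_intros g)
  from Poisson_formula[OF this assms(2,3)]
  have *: "((\<lambda>t. of_real (poisson_kernel w t) * k (cis t)) has_integral of_real (2 * pi) * k w) {0..2 * pi}" .
  have contk: "continuous_on (ball 0 R) k"
    using \<open>k holomorphic_on ball 0 R\<close> holomorphic_on_imp_continuous_on by blast
  have "norm (of_real (2 * pi) * k w) \<le> integral {0..2 * pi} (\<lambda>t. poisson_kernel w t * norm (k (cis t)))"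
    unfolding integral_unique[OF *, symmetric]
    by (rule integral_norm_bound_integral)
       (use assms in \<open>auto simp: norm_mult poisson_kernel_nonneg intro!: has_integral_integrable[OF *] integrable_continuous_real continuous_intros
         continuous_on_poisson_kernel continuous_on_compose2[OF contk] intro: poisson_kernel_nonneg\<close>)
  also have "\<dots> = integral {0..2 * pi} (\<lambda>t. poisson_kernel w t * norm (f (cis t)) powr p)"
    using assms by (simp add: k)
  finally show ?thesis using assms by (simp add: norm_mult k)
qed

text \<open>
  A zero \<open>a\<close> of order \<open>n\<close> is removed by trading \<open>(z - a) ^ n\<close> for \<open>(1 - cnj a * z) ^ n\<close>: the modulus
  does not change on the circle and does not decrease inside. The induction is on the number of
  distinct zeros.
\<close>
lemma norm_powr_le_poisson:
  assumes "f holomorphic_on ball 0 R" "1 < R" "norm w < 1" "0 \<le> p"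
    and "\<And>z. norm z = 1 \<Longrightarrow> f z \<noteq> 0"
  shows "2 * pi * norm (f w) powr p \<le> integral {0..2 * pi} (\<lambda>t. poisson_kernel w t * norm (f (cis t)) powr p)"
  using assms(1,5)
proof (induction "card {z \<in> cball 0 1. f z = 0}" arbitrary: f rule: less_induct)
  case (less f)
  let ?Z = "{z \<in> cball 0 1. f z = 0}"
  have f1: "f 1 \<noteq> 0" using less.prems(2) by simp
  have sub: "cball 0 1 \<subseteq> ball (0::complex) R" using assms by auto
  have fin: "finite ?Z"
  proof (cases "f constant_on ball 0 R")
    case True
    then obtain c where c: "\<And>z. z \<in> ball 0 R \<Longrightarrow> f z = c" by (auto simp: constant_on_def)
    then have "c \<noteq> 0" using f1 assms(2) by (metis sub mem_cball_0 norm_one order_refl subsetD)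
    then have "?Z = {}" using c sub by auto
    then show ?thesis using finite.emptyI by metis
  next
    case False
    then show ?thesis
      by (intro holomorphic_compact_finite_zeros[OF less.prems(1)]) (use sub in auto)
  qed
  show ?case
  proof (cases "?Z = {}")
    case True
    have "open (ball 0 R \<inter> f -` (- {0}))"
      using holomorphic_on_imp_continuous_on[OF less.prems(1)]
      by (intro continuous_open_preimage) auto
    moreover have "cball 0 1 \<subseteq> ball 0 R \<inter> f -` (- {0})" using True sub by auto
    ultimately obtain R' where R': "1 < R'" "ball 0 R' \<subseteq> ball 0 R \<inter> f -` (- {0})"
      by (rule cball_enlarge_in_open[of _ 1]) auto
    show ?thesis
      by (rule norm_powr_le_poisson_nonzero[where R = R'])
         (use R' assms in \<open>auto intro: holomorphic_on_subset[OF less.prems(1)]\<close>)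
  next
    case False
    then obtain a where a: "norm a \<le> 1" "f a = 0" by auto
    have a1: "norm a < 1" using a less.prems(2)[of a] by (cases "norm a = 1") auto
    define n where "n = nat (zorder f a)"
    have ex: "\<exists>z\<in>ball 0 R. f z \<noteq> 0" using f1 assms(2) by (intro bexI[of _ 1]) auto
    have "0 < zorder f a"
      using zorder_exist_zero[OF less.prems(1) _ _ _ ex, of a] a a1 assms(2) by auto
    then have n: "zorder f a = int n" "0 < n" by (auto simp: n_def)
    obtain q where q: "q holomorphic_on ball 0 R" "\<And>z. z \<in> ball 0 R \<Longrightarrow> f z = (z - a) ^ n * q z" "q a \<noteq> 0"
    proof (rule holomorphic_divide_zorder[of "ball 0 R" f "\<lambda>z. (z - a) ^ n"])
      show "\<exists>z\<in>ball 0 R. f z \<noteq> 0" by (rule ex)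
      show "\<exists>z\<in>ball 0 R. (z - a) ^ n \<noteq> 0" using a1 assms(2) by (auto intro!: bexI[of _ 1])
      show "zorder (\<lambda>z. (z - a) ^ n) w \<le> zorder f w" if "(w - a) ^ n = 0" for w
        using that n by (simp add: zorder_power_diff)
      show "(\<lambda>z. (z - a) ^ n) holomorphic_on ball 0 R" by (intro holomorphic_intros)
      fix q assume q: "q holomorphic_on ball 0 R" "\<And>z. z \<in> ball 0 R \<Longrightarrow> f z = (z - a) ^ n * q z"
        "\<And>w. w \<in> ball 0 R \<Longrightarrow> zorder f w = zorder (\<lambda>z. (z - a) ^ n) w \<Longrightarrow> q w \<noteq> 0"
      have "q a \<noteq> 0" using q(3)[of a] a1 assms(2) n by (simp add: zorder_power_diff)
      with q(1,2) show thesis by (rule that)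
    qed (use less.prems(1) in simp_all)
    \<comment> \<open>The reflected factor has its zero outside the closed disk.\<close>
    define g where "g z = (1 - cnj a * z) ^ n * q z" for z
    have g_holo: "g holomorphic_on ball 0 R" unfolding g_def by (intro holomorphic_intros q)
    have norm_eq: "norm (g z) = norm (f z)" if "norm z = 1" for z
      using q(2)[of z] that assms(2) moebius_norm_eq[OF that, of a] by (simp add: g_def norm_mult norm_power)
    have norm_le: "norm (f z) \<le> norm (g z)" if "norm z \<le> 1" for z
    proof -
      have "norm (f z) = norm (z - a) ^ n * norm (q z)"
        using q(2)[of z] that assms(2) by (simp add: norm_mult norm_power)
      also have "\<dots> \<le> norm (1 - cnj a * z) ^ n * norm (q z)"
        using that a1 by (intro mult_right_mono power_mono moebius_norm_le) auto
      finally show ?thesis by (simp add: g_def norm_mult norm_power)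
    qed
    have "{z \<in> cball 0 1. g z = 0} \<subseteq> ?Z"
      using moebius_denominator_nonzero[OF a1] q(2) sub by (auto simp: g_def)
    moreover have "a \<in> ?Z" "g a \<noteq> 0"
      using moebius_denominator_nonzero[OF a1, of a] q(3) a by (auto simp: g_def)
    ultimately have "{z \<in> cball 0 1. g z = 0} \<subset> ?Z" by blast
    then have "card {z \<in> cball 0 1. g z = 0} < card ?Z"
      using fin by (intro psubset_card_mono)
    moreover have "g z \<noteq> 0" if "norm z = 1" for z
      using norm_eq[OF that] less.prems(2)[OF that] by auto
    ultimately have "2 * pi * norm (g w) powr p \<le> integral {0..2 * pi} (\<lambda>t. poisson_kernel w t * norm (g (cis t)) powr p)"
      by (intro less.hyps[of g] g_holo)
    moreover have "norm (f w) powr p \<le> norm (g w) powr p"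
      using norm_le[of w] assms(3,4) by (intro powr_mono2) auto
    then have "2 * pi * norm (f w) powr p \<le> 2 * pi * norm (g w) powr p"
      by (intro mult_left_mono) auto
    ultimately have "2 * pi * norm (f w) powr p \<le> integral {0..2 * pi} (\<lambda>t. poisson_kernel w t * norm (g (cis t)) powr p)"
      by linarith
    then show ?thesis by (simp add: norm_eq)
  qed
qed

lemma poisson_kernel_le:
  assumes "norm z < 1"
  shows "poisson_kernel z t \<le> (1 + norm z) / (1 - norm z)"
proof -
  have "1 - norm z \<le> norm (cis t - z)"
    using norm_triangle_ineq2[of "cis t" z] by simp
  then have "(1 - norm z)\<^sup>2 \<le> (norm (cis t - z))\<^sup>2" using assms by (intro power_mono) auto
  then have "poisson_kernel z t \<le> (1 - (norm z)\<^sup>2) / (1 - norm z)\<^sup>2"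
    unfolding poisson_kernel_def using assms
    by (intro divide_left_mono) (auto simp: power_le_one cis_neq)
  also have "1 - (norm z)\<^sup>2 = (1 + norm z) * (1 - norm z)"
    by (simp add: power2_eq_square algebra_simps)
  also have "\<dots> / (1 - norm z)\<^sup>2 = (1 + norm z) / (1 - norm z)"
    using assms by (simp add: power2_eq_square)
  finally show ?thesis .
qed

lemma Re_of_real_mult: "Re (of_real a * z) = a * Re z"
  by simp

text \<open>
  Mean value property of the harmonic function \<open>z \<mapsto> poisson_kernel (\<psi> z) t\<close>.
\<close>
lemma poisson_kernel_mean:
  assumes "\<psi> holomorphic_on ball 0 R" "1 < R" "\<psi> ` ball 0 R \<subseteq> ball 0 1"
  shows "((\<lambda>s. poisson_kernel (\<psi> (cis s)) t) has_integral 2 * pi * poisson_kernel (\<psi> 0) t) {0..2 * pi}"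
proof -
  have "cis t - \<psi> z \<noteq> 0" if "z \<in> ball 0 R" for z
    using assms(3) that cis_neq[of "\<psi> z" t] by (auto simp: image_subset_iff)
  then have "(\<lambda>z. (cis t + \<psi> z) / (cis t - \<psi> z)) holomorphic_on ball 0 R"
    by (intro holomorphic_intros assms)
  from has_integral_Re[OF Poisson_formula[OF this assms(2), of 0]] show ?thesis
    unfolding poisson_kernel_eq_Re[of "\<psi> _"] Re_of_real_mult by (simp add: poisson_kernel_def)
qed

text \<open>
  Littlewood's subordination principle on a fixed circle: integrate \<open>norm_powr_le_poisson\<close> at the
  points \<open>\<psi> (cis s)\<close> over \<open>s\<close> and exchange the integrals. By the mean value property only the kernel
  at \<open>\<psi> 0\<close> survives, and it is bounded by Harnack's constant.
\<close>
lemma subordination_circle: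
  assumes f: "f holomorphic_on ball 0 R" "\<And>z. norm z = 1 \<Longrightarrow> f z \<noteq> 0" and R: "1 < R" and p: "0 < p"
    and \<psi>: "\<psi> holomorphic_on ball 0 R" "\<psi> ` ball 0 R \<subseteq> ball 0 1"
  shows "integral {0..2 * pi} (\<lambda>s. norm (f (\<psi> (cis s))) powr p)
    \<le> (1 + norm (\<psi> 0)) / (1 - norm (\<psi> 0)) * integral {0..2 * pi} (\<lambda>t. norm (f (cis t)) powr p)"
proof -
  let ?F = "\<lambda>t. norm (f (cis t)) powr p"
  let ?C = "(1 + norm (\<psi> 0)) / (1 - norm (\<psi> 0))"
  have \<psi>1: "norm (\<psi> z) < 1" if "norm z < R" for z using \<psi>(2) that by (auto simp: image_subset_iff)
  have cf: "continuous_on (ball 0 R) f" "continuous_on (ball 0 R) \<psi>"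
    using f \<psi> holomorphic_on_imp_continuous_on by auto
  have contF: "continuous_on X (\<lambda>x. ?F (g x))" if "continuous_on X g" for X :: "'a::topological_space set" and g
    using f(2) R that by (intro continuous_on_powr' continuous_intros continuous_on_compose2[OF cf(1)]) auto
  have contPsi: "continuous_on X (\<lambda>x. \<psi> (cis (g x)))" if "continuous_on X g" for X :: "'a::topological_space set" and g
    using R that by (intro continuous_intros continuous_on_compose2[OF cf(2)]) auto
  have contG: "continuous_on {0..2*pi} (\<lambda>s. norm (f (\<psi> (cis s))) powr p)"
  proof -
    have "\<psi> (cis s) \<in> ball 0 R" for s using \<psi>1[of "cis s"] R by simp
    then show ?thesis using p
      by (intro continuous_on_powr' continuous_intros continuous_on_compose2[OF cf(1)] contPsi) auto
  qed
  have cont2: "continuous_on (cbox (0, 0) (2 * pi, 2 * pi)) (\<lambda>(s, t). poisson_kernel (\<psi> (cis s)) t * ?F t)"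
    using R unfolding split_beta
    by (intro continuous_intros contF continuous_on_poisson_kernel contPsi) (auto intro!: \<psi>1)
  have "2 * pi * integral {0..2 * pi} (\<lambda>s. norm (f (\<psi> (cis s))) powr p)
      = integral {0..2 * pi} (\<lambda>s. 2 * pi * norm (f (\<psi> (cis s))) powr p)"
    by simp
  also have "\<dots> \<le> integral {0..2 * pi} (\<lambda>s. integral {0..2 * pi} (\<lambda>t. poisson_kernel (\<psi> (cis s)) t * ?F t))"
  proof (rule integral_le)
    show "(\<lambda>s. 2 * pi * norm (f (\<psi> (cis s))) powr p) integrable_on {0..2 * pi}"
      by (intro integrable_continuous_real continuous_intros contG)
    show "(\<lambda>s. integral {0..2 * pi} (\<lambda>t. poisson_kernel (\<psi> (cis s)) t * ?F t)) integrable_on {0..2 * pi}"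
      using integral_integrable_2dim[OF cont2] by simp
  qed (use R p f in \<open>auto intro!: norm_powr_le_poisson \<psi>1\<close>)
  also have "\<dots> = integral {0..2 * pi} (\<lambda>t. integral {0..2 * pi} (\<lambda>s. poisson_kernel (\<psi> (cis s)) t * ?F t))"
    using integral_swap_continuous[OF cont2] by simp
  also have "\<dots> = integral {0..2 * pi} (\<lambda>t. 2 * pi * poisson_kernel (\<psi> 0) t * ?F t)"
    by (simp add: integral_unique[OF poisson_kernel_mean[OF \<psi>(1) R \<psi>(2)]])
  also have "\<dots> \<le> integral {0..2 * pi} (\<lambda>t. 2 * pi * (?C * ?F t))"
  proof (rule integral_le)
    fix t
    show "2 * pi * poisson_kernel (\<psi> 0) t * ?F t \<le> 2 * pi * (?C * ?F t)"
      unfolding mult.assoc[of "2 * pi"] using poisson_kernel_le[of "\<psi> 0" t] \<psi>1[of 0] R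
      by (intro mult_left_mono mult_right_mono) auto
  qed (use \<psi>1[of 0] R in \<open>auto intro!: integrable_continuous_real continuous_intros continuous_on_poisson_kernel contF\<close>)
  also have "\<dots> = 2 * pi * (?C * integral {0..2 * pi} ?F)" by simp
  finally show ?thesis by (rule mult_left_le_imp_le) simp
qed

section \<open>Hardy spaces\<close>

definition power_mean_integral :: "real \<Rightarrow> (complex \<Rightarrow> complex) \<Rightarrow> real \<Rightarrow> real" where
  "power_mean_integral p f r = integral {0..2 * pi} (\<lambda>t. norm (f (of_real r * cis t)) powr p)"

lemma hardy_space_iff:
  "f \<in> hardy_space p \<longleftrightarrow> f holomorphic_on unit_disk \<and> (\<exists>M. \<forall>r\<in>{0<..<1}. power_mean_integral p f r \<le> M)"
proof -
  have "(\<exists>M. \<forall>r\<in>{0<..<1}. 1 / (2 * pi) * power_mean_integral p f r \<le> M)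
      \<longleftrightarrow> (\<exists>M. \<forall>r\<in>{0<..<1}. power_mean_integral p f r \<le> M)"
  proof safe
    fix M assume "\<forall>r\<in>{0<..<1}. 1 / (2 * pi) * power_mean_integral p f r \<le> M"
    then have "\<forall>r\<in>{0<..<1}. power_mean_integral p f r \<le> 2 * pi * M"
      by (auto simp: field_simps)
    then show "\<exists>M. \<forall>r\<in>{0<..<1}. power_mean_integral p f r \<le> M" by blast
  next
    fix M assume "\<forall>r\<in>{0<..<1}. power_mean_integral p f r \<le> M"
    then have "\<forall>r\<in>{0<..<1}. 1 / (2 * pi) * power_mean_integral p f r \<le> M / (2 * pi)"
      by (auto simp: field_simps)
    then show "\<exists>M. \<forall>r\<in>{0<..<1}. 1 / (2 * pi) * power_mean_integral p f r \<le> M" by blast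
  qed
  then show ?thesis
    unfolding hardy_space_def mem_Collect_eq bdd_above_def ball_simps power_mean_integral_def by simp
qed

lemma norm_radius_cis [simp]: "0 \<le> r \<Longrightarrow> norm (of_real r * cis t) = r"
  by (simp add: norm_mult)

lemma continuous_on_circle_powr:
  assumes "f holomorphic_on unit_disk" "0 < p" "0 \<le> r" "r < 1"
  shows "continuous_on A (\<lambda>t. norm (f (of_real r * cis t)) powr p)"
  using assms
  by (intro continuous_on_powr' continuous_intros
      continuous_on_compose2[OF holomorphic_on_imp_continuous_on[OF assms(1)]]) auto

lemma power_mean_integral_mono:
  assumes "f holomorphic_on unit_disk" "g holomorphic_on unit_disk" "0 < p" "0 \<le> r" "r < 1" "0 \<le> c"
    and "\<And>z. norm z = r \<Longrightarrow> norm (f z) \<le> c * norm (g z)"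
  shows "power_mean_integral p f r \<le> c powr p * power_mean_integral p g r"
proof -
  have "power_mean_integral p f r \<le> integral {0..2 * pi} (\<lambda>t. c powr p * norm (g (of_real r * cis t)) powr p)"
    unfolding power_mean_integral_def
  proof (rule integral_le)
    fix t
    have "norm (f (of_real r * cis t)) powr p \<le> (c * norm (g (of_real r * cis t))) powr p"
      using assms by (intro powr_mono2) auto
    then show "norm (f (of_real r * cis t)) powr p \<le> c powr p * norm (g (of_real r * cis t)) powr p"
      using assms by (simp add: powr_mult)
  qed (use assms in \<open>auto intro!: integrable_continuous_real continuous_on_mult continuous_on_const continuous_on_circle_powr\<close>)
  then show ?thesis by (simp add: power_mean_integral_def)
qed

text \<open>
  The inequalities above require \<open>f\<close> not to vanish on the outer circle. As zeros are isolated,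
  such circles exist arbitrarily close to the unit circle, which is enough for estimates that are
  uniform in the radius.
\<close>
lemma exists_zero_free_circle:
  assumes "f holomorphic_on unit_disk" "\<exists>z\<in>unit_disk. f z \<noteq> 0" "s < 1"
  obtains R where "s < R" "0 < R" "R < 1" "\<And>z. norm z = R \<Longrightarrow> f z \<noteq> 0"
proof -
  define s' where "s' = (1 + max s 0) / 2"
  have s': "s' < 1" "s < s'" "0 < s'" using assms(3) by (auto simp: s'_def)
  have fin: "finite {z \<in> cball 0 s'. f z = 0}"
  proof (cases "f constant_on unit_disk")
    case True
    then have "{z \<in> cball 0 s'. f z = 0} = {}" using assms(2) s' by (auto simp: constant_on_def)
    then show ?thesis using finite.emptyI by metis
  next
    case False
    then show ?thesis
      by (intro holomorphic_compact_finite_zeros[OF assms(1)]) (use s' in auto)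
  qed
  have "infinite {max s 0<..<s'}" using s' by (intro infinite_Ioo) auto
  then obtain R where R: "R \<in> {max s 0<..<s'}" "R \<notin> norm ` {z \<in> cball 0 s'. f z = 0}"
    using fin by (meson finite_imageI finite_subset subsetI)
  then show ?thesis using s' by (intro that[of R]) auto
qed

text \<open>
  Rescaling the circles of radii \<open>r\<close> and \<open>R\<close> to the unit circle reduces this to
  \<open>subordination_circle\<close>.
\<close>
lemma power_mean_subordination:
  assumes f: "f holomorphic_on unit_disk" "\<And>z. norm z = R \<Longrightarrow> f z \<noteq> 0" and R: "0 < R" "R < 1" and p: "0 < p"
    and r: "0 < r" "r < 1"
    and \<phi>: "\<phi> holomorphic_on unit_disk" "\<phi> ` cball 0 r \<subseteq> ball 0 R"
  shows "power_mean_integral p (f \<circ> \<phi>) r \<le> (R + norm (\<phi> 0)) / (R - norm (\<phi> 0)) * power_mean_integral p f R"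
proof -
  have "open (unit_disk \<inter> \<phi> -` ball 0 R)"
    using holomorphic_on_imp_continuous_on[OF \<phi>(1)] by (intro continuous_open_preimage) auto
  moreover have "cball 0 r \<subseteq> unit_disk \<inter> \<phi> -` ball 0 R" using \<phi>(2) r by auto
  ultimately obtain r' where r': "r < r'" "ball 0 r' \<subseteq> unit_disk \<inter> \<phi> -` ball 0 R"
    using r(1) by (metis cball_enlarge_in_open less_imp_le)
  define R' where "R' = min (1 / R) (r' / r)"
  have R': "1 < R'" using R r r' by (auto simp: R'_def)
  define g where "g z = f (of_real R * z)" for z
  define \<psi> where "\<psi> z = \<phi> (of_real r * z) / of_real R" for z
  have in1: "of_real R * z \<in> unit_disk" "of_real r * z \<in> ball 0 r'" if "z \<in> ball 0 R'" for z
    using that R r by (auto simp: R'_def norm_mult field_simps)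
  then have in2: "of_real r * z \<in> unit_disk" "\<phi> (of_real r * z) \<in> ball 0 R" if "z \<in> ball 0 R'" for z
    using that r' by blast+
  have "g holomorphic_on ball 0 R'" unfolding g_def using in1
    by (intro holomorphic_on_compose_gen[OF _ f(1), unfolded o_def]) (auto intro!: holomorphic_intros)
  moreover have "g z \<noteq> 0" if "norm z = 1" for z
    using f(2)[of "of_real R * z"] that R by (simp add: g_def norm_mult)
  moreover have "\<psi> holomorphic_on ball 0 R'" unfolding \<psi>_def using in2 R
    by (intro holomorphic_intros holomorphic_on_compose_gen[OF _ \<phi>(1), unfolded o_def]) (auto intro!: holomorphic_intros)
  moreover have "\<psi> ` ball 0 R' \<subseteq> ball 0 1"
    using in2 R by (auto simp: \<psi>_def norm_divide)
  ultimately have "integral {0..2 * pi} (\<lambda>s. norm (g (\<psi> (cis s))) powr p)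
    \<le> (1 + norm (\<psi> 0)) / (1 - norm (\<psi> 0)) * integral {0..2 * pi} (\<lambda>t. norm (g (cis t)) powr p)"
    by (intro subordination_circle[OF _ _ R' p]) auto
  moreover have "(1 + norm (\<psi> 0)) / (1 - norm (\<psi> 0)) = (R + norm (\<phi> 0)) / (R - norm (\<phi> 0))"
  proof -
    have "R + norm (\<phi> 0) = (1 + norm (\<psi> 0)) * R" "R - norm (\<phi> 0) = (1 - norm (\<psi> 0)) * R"
      using R by (simp_all add: \<psi>_def norm_divide field_simps)
    then show ?thesis using R by simp
  qed
  ultimately have "integral {0..2 * pi} (\<lambda>s. norm (g (\<psi> (cis s))) powr p)
    \<le> (R + norm (\<phi> 0)) / (R - norm (\<phi> 0)) * integral {0..2 * pi} (\<lambda>t. norm (g (cis t)) powr p)"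
    by (simp only:)
  moreover have "of_real R * \<psi> z = \<phi> (of_real r * z)" for z using R by (simp add: \<psi>_def)
  ultimately show ?thesis by (simp add: power_mean_integral_def g_def)
qed

lemma power_mean_radius_mono:
  assumes "f holomorphic_on unit_disk" "\<And>z. norm z = R \<Longrightarrow> f z \<noteq> 0" "0 < r" "r < R" "R < 1" "0 < p"
  shows "power_mean_integral p f r \<le> power_mean_integral p f R"
proof -
  have "cball 0 r \<subseteq> ball (0::complex) R" using assms by auto
  then show ?thesis
    using power_mean_subordination[OF assms(1,2) _ assms(5,6), of r "\<lambda>z. z"] assms by (simp add: o_def)
qed

text \<open>
  Every radius \<open>r\<close> is compared with some \<open>R\<close> close to 1; keeping \<open>R\<close> above \<open>(1 + |\<phi> 0|) / 2\<close> makes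
  the constant in \<open>power_mean_subordination\<close> independent of \<open>r\<close>.
\<close>
lemma hardy_space_comp:
  assumes f: "f \<in> hardy_space p" and p: "0 < p"
    and \<phi>: "\<phi> holomorphic_on unit_disk" "\<phi> ` unit_disk \<subseteq> unit_disk"
  shows "f \<circ> \<phi> \<in> hardy_space p"
proof -
  obtain M where M: "\<And>r. r \<in> {0<..<1} \<Longrightarrow> power_mean_integral p f r \<le> M"
    and holo: "f holomorphic_on unit_disk"
    using f unfolding hardy_space_iff by blast
  let ?x = "norm (\<phi> 0)"
  have x: "?x < 1" using \<phi>(2) by (auto simp: image_subset_iff)
  have "power_mean_integral p (f \<circ> \<phi>) r \<le> 4 / (1 - ?x) * max M 0" if r: "r \<in> {0<..<1}" for r
  proof (cases "\<exists>z\<in>unit_disk. f z \<noteq> 0")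
    case False
    have "\<phi> (of_real r * cis t) \<in> unit_disk" for t
      using \<phi>(2) r by (auto simp: image_subset_iff)
    then have "f (\<phi> (of_real r * cis t)) = 0" for t using False by blast
    then show ?thesis using x p by (simp add: power_mean_integral_def)
  next
    case True
    have "compact (\<phi> ` cball 0 r)"
      using r by (intro compact_continuous_image continuous_on_subset[OF holomorphic_on_imp_continuous_on[OF \<phi>(1)]]) auto
    moreover have "\<phi> ` cball 0 r \<noteq> {}" using r by auto
    ultimately obtain y where y: "y \<in> \<phi> ` cball 0 r" "\<And>u. u \<in> \<phi> ` cball 0 r \<Longrightarrow> norm u \<le> norm y"
      using continuous_attains_sup[of "\<phi> ` cball 0 r" norm] continuous_on_norm_id by blast
    have "norm y < 1" using y(1) \<phi>(2) r by (auto simp: image_subset_iff)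
    then obtain R where R: "max (norm y) ((1 + ?x) / 2) < R" "0 < R" "R < 1" "\<And>z. norm z = R \<Longrightarrow> f z \<noteq> 0"
      using exists_zero_free_circle[OF holo True, of "max (norm y) ((1 + ?x) / 2)"] x by auto
    have "power_mean_integral p (f \<circ> \<phi>) r \<le> (R + ?x) / (R - ?x) * power_mean_integral p f R"
      by (rule power_mean_subordination[OF holo R(4) R(2,3) p]) (use r \<phi> y R(1) in force)+
    also have "\<dots> \<le> (R + ?x) / (R - ?x) * max M 0"
      using M[of R] R x by (intro mult_left_mono) auto
    also have "\<dots> \<le> 4 / (1 - ?x) * max M 0"
    proof (rule mult_right_mono)
      have "(R + ?x) / (R - ?x) \<le> 2 / ((1 - ?x) / 2)"
        using R x by (intro frac_le) auto
      then show "(R + ?x) / (R - ?x) \<le> 4 / (1 - ?x)" by simp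
    qed auto
    finally show ?thesis .
  qed
  moreover have "f \<circ> \<phi> holomorphic_on unit_disk"
    using holomorphic_on_compose_gen[OF \<phi>(1) holo \<phi>(2)] .
  ultimately show ?thesis unfolding hardy_space_iff by blast
qed

lemma hardy_space_bounded_mult:
  assumes "f \<in> hardy_space p" "0 < p" "g holomorphic_on unit_disk" "\<And>z. z \<in> unit_disk \<Longrightarrow> norm (g z) \<le> C"
  shows "(\<lambda>z. g z * f z) \<in> hardy_space p"
proof -
  obtain M where M: "\<And>r. r \<in> {0<..<1} \<Longrightarrow> power_mean_integral p f r \<le> M"
    and holo: "f holomorphic_on unit_disk"
    using assms(1) unfolding hardy_space_iff by blast
  have C: "0 \<le> C" using order_trans[OF norm_ge_zero assms(4)[of 0]] by simp
  have "power_mean_integral p (\<lambda>z. g z * f z) r \<le> C powr p * M" if "r \<in> {0<..<1}" for r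
  proof -
    have "power_mean_integral p (\<lambda>z. g z * f z) r \<le> C powr p * power_mean_integral p f r"
      using that assms C by (intro power_mean_integral_mono holo holomorphic_intros)
         (auto simp: norm_mult intro!: mult_right_mono)
    also have "\<dots> \<le> C powr p * M" using M[OF that] by (intro mult_left_mono) auto
    finally show ?thesis .
  qed
  moreover have "(\<lambda>z. g z * f z) holomorphic_on unit_disk" using holo assms(3) by (intro holomorphic_intros)
  ultimately show ?thesis unfolding hardy_space_iff by blast
qed

lemma one_in_hardy_space: "0 < p \<Longrightarrow> (\<lambda>_. 1) \<in> hardy_space p"
  unfolding hardy_space_iff power_mean_integral_def by (auto intro!: exI[of _ "2 * pi"])

lemma unimodular_near_circle:
  fixes P :: "complex \<Rightarrow> complex"
  assumes "continuous_on (cball 0 1) P" "\<And>z. norm z = 1 \<Longrightarrow> norm (P z) = 1" "\<delta> < 1"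
  obtains s where "s < 1" "\<And>z. s < norm z \<Longrightarrow> norm z \<le> 1 \<Longrightarrow> \<delta> < norm (P z)"
proof -
  define K where "K = cball 0 1 \<inter> P -` cball 0 \<delta>"
  have K: "compact K" unfolding K_def compact_eq_bounded_closed
    using assms(1) by (auto intro: continuous_closed_preimage bounded_subset[OF bounded_cball[of 0 1]])
  show ?thesis
  proof (cases "K = {}")
    case True
    show ?thesis by (rule that[of 0]) (use True in \<open>force simp: K_def\<close>)+
  next
    case False
    then obtain y where y: "y \<in> K" "\<And>z. z \<in> K \<Longrightarrow> norm z \<le> norm y"
      using continuous_attains_sup[OF K, of norm] continuous_on_norm_id by blast
    have "norm y \<noteq> 1" using y(1) assms(2)[of y] assms(3) by (auto simp: K_def)
    then show ?thesis using y
      by (intro that[of "norm y"]) (force simp: K_def)+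
  qed
qed

text \<open>
  Dividing by \<open>P\<close> costs a factor close to 1 on circles close to the unit circle, and the means of
  \<open>q\<close> increase with the radius.
\<close>
lemma power_mean_divide_unimodular:
  assumes P: "continuous_on (cball 0 1) P" "\<And>z. norm z = 1 \<Longrightarrow> norm (P z) = 1" "P holomorphic_on unit_disk"
    and q: "q holomorphic_on unit_disk" and p: "0 < p" and r: "0 < r" "r < 1"
    and M: "\<And>R. 0 < R \<Longrightarrow> R < 1 \<Longrightarrow> power_mean_integral p (\<lambda>z. P z * q z) R \<le> M"
  shows "power_mean_integral p q r \<le> M"
proof (cases "\<exists>z\<in>unit_disk. q z \<noteq> 0")
  case False
  have "q (of_real r * cis t) = 0" "P (of_real r * cis t) * q (of_real r * cis t) = 0" for t
    using False r by auto
  then show ?thesis using M[OF r] by (simp add: power_mean_integral_def)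
next
  case True
  show ?thesis
  proof (rule field_le_mult_one_interval)
    fix x :: real assume x: "0 < x" "x < 1"
    define \<delta> where "\<delta> = x powr (1 / p)"
    have \<delta>: "0 < \<delta>" "\<delta> < 1" "\<delta> powr p = x"
      using x p powr_less_mono2[of "1 / p" x 1] by (auto simp: \<delta>_def powr_powr)
    obtain s where s: "s < 1" "\<And>z. s < norm z \<Longrightarrow> norm z \<le> 1 \<Longrightarrow> \<delta> < norm (P z)"
      using unimodular_near_circle[OF P(1,2) \<delta>(2)] by metis
    obtain R where R: "max s r < R" "0 < R" "R < 1" "\<And>z. norm z = R \<Longrightarrow> q z \<noteq> 0"
      using exists_zero_free_circle[OF q True, of "max s r"] s r by auto
    have "power_mean_integral p q r \<le> power_mean_integral p q R"
      using R r p by (intro power_mean_radius_mono q) auto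
    also have "\<dots> \<le> (1 / \<delta>) powr p * power_mean_integral p (\<lambda>z. P z * q z) R"
    proof (rule power_mean_integral_mono)
      fix z :: complex assume "norm z = R"
      then have "\<delta> \<le> norm (P z)" using s(2)[of z] R by auto
      then have "\<delta> * norm (q z) \<le> norm (P z * q z)" by (simp add: norm_mult mult_right_mono)
      then show "norm (q z) \<le> 1 / \<delta> * norm (P z * q z)" using \<delta>(1) by (simp add: field_simps)
    qed (use R p \<delta> q P in \<open>auto intro!: holomorphic_intros\<close>)
    also have "\<dots> \<le> (1 / \<delta>) powr p * M"
      using M[of R] R by (intro mult_left_mono) auto
    also have "(1 / \<delta>) powr p = 1 / x" using \<delta> by (simp add: powr_divide)
    finally show "x * power_mean_integral p q r \<le> M" using x by (simp add: field_simps)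
  qed
qed

text \<open>
  The analogue for the supremum norm, with the maximum modulus principle in place of the
  monotonicity of the means.
\<close>
lemma norm_divide_unimodular_le:
  assumes P: "continuous_on (cball 0 1) P" "\<And>z. norm z = 1 \<Longrightarrow> norm (P z) = 1"
    and q: "q holomorphic_on unit_disk" and w: "norm w < 1"
    and M: "\<And>z. norm z < 1 \<Longrightarrow> norm (P z * q z) \<le> M"
  shows "norm (q w) \<le> M"
proof (rule field_le_mult_one_interval)
  fix \<delta> :: real assume \<delta>: "0 < \<delta>" "\<delta> < 1"
  obtain s where s: "s < 1" "\<And>z. s < norm z \<Longrightarrow> norm z \<le> 1 \<Longrightarrow> \<delta> < norm (P z)"
    using unimodular_near_circle[OF P \<delta>(2)] by metis
  define R where "R = (1 + max s (norm w)) / 2"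
  have R: "s < R" "norm w < R" "R < 1" using s w by (auto simp: R_def max_def)
  have R0: "0 < R" using R norm_ge_zero[of w] by linarith
  have "norm (q w) \<le> M / \<delta>"
  proof (rule maximum_modulus_frontier[of q "cball 0 R"])
    show "q holomorphic_on interior (cball 0 R)"
      using R by (intro holomorphic_on_subset[OF q]) auto
    show "continuous_on (closure (cball 0 R)) q"
      using R by (intro continuous_on_subset[OF holomorphic_on_imp_continuous_on[OF q]]) auto
    fix z :: complex assume "z \<in> frontier (cball 0 R)"
    then have z: "norm z = R" using R0 by simp
    then have "\<delta> * norm (q z) \<le> norm (P z * q z)"
      using s(2)[of z] R by (simp add: norm_mult mult_right_mono)
    also have "\<dots> \<le> M" using M z R by auto
    finally show "norm (q z) \<le> M / \<delta>" using \<delta> by (simp add: field_simps)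
  qed (use R in auto)
  then show "\<delta> * norm (q w) \<le> M" using \<delta> by (simp add: field_simps)
qed

section \<open>Blaschke products\<close>

lemma blaschke_factor_holomorphic: "norm a < 1 \<Longrightarrow> blaschke_factor a holomorphic_on unit_disk"
  unfolding blaschke_factor_def using moebius_denominator_nonzero[of a]
  by (auto intro!: holomorphic_intros)

lemma continuous_on_blaschke_factor: "norm a < 1 \<Longrightarrow> a \<noteq> 0 \<Longrightarrow> continuous_on (cball 0 1) (blaschke_factor a)"
  unfolding blaschke_factor_def using moebius_denominator_nonzero[of a]
  by (auto intro!: continuous_intros)

lemma norm_blaschke_factor:
  "a \<noteq> 0 \<Longrightarrow> norm (blaschke_factor a z) = norm (z - a) / norm (1 - cnj a * z)"
  by (simp add: blaschke_factor_def norm_mult norm_divide norm_minus_commute)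

lemma norm_blaschke_factor_le_1:
  assumes "a \<noteq> 0" "norm a < 1" "norm z \<le> 1"
  shows "norm (blaschke_factor a z) \<le> 1"
  using moebius_norm_le[of a z] assms moebius_denominator_nonzero[OF assms(2,3)]
  by (simp add: norm_blaschke_factor)

lemma norm_blaschke_factor_eq_1:
  assumes "a \<noteq> 0" "norm a < 1" "norm z = 1"
  shows "norm (blaschke_factor a z) = 1"
  using moebius_norm_eq[OF assms(3), of a] assms moebius_denominator_nonzero[OF assms(2), of z]
  unfolding norm_blaschke_factor[OF assms(1)] by auto

lemma blaschke_factor_eq_0_iff:
  assumes "a \<noteq> 0" "norm a < 1" "norm z \<le> 1"
  shows "blaschke_factor a z = 0 \<longleftrightarrow> z = a"
  using assms moebius_denominator_nonzero[OF assms(2,3)] by (auto simp: blaschke_factor_def)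

text \<open>
  This estimate turns the Blaschke condition into locally uniform convergence of the product.
\<close>
lemma norm_blaschke_factor_minus_1_le:
  assumes "a \<noteq> 0" "norm a < 1" "norm z \<le> r" "r < 1"
  shows "norm (blaschke_factor a z - 1) \<le> 2 / (1 - r) * (1 - norm a)"
proof -
  have nz: "1 - cnj a * z \<noteq> 0" using assms by (intro moebius_denominator_nonzero) auto
  have *: "cnj a * a = of_real (norm a) * of_real (norm a)"
    by (metis complex_norm_square mult.commute power2_eq_square of_real_power)
  have "blaschke_factor a z - 1 = (of_real (norm a) * (a - z) - a * (1 - cnj a * z)) / (a * (1 - cnj a * z))"
  proof -
    have "blaschke_factor a z - 1 = of_real (norm a) * (a - z) / (a * (1 - cnj a * z))
        - a * (1 - cnj a * z) / (a * (1 - cnj a * z))"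
      using assms(1) nz by (simp add: blaschke_factor_def)
    then show ?thesis unfolding diff_divide_distrib .
  qed
  also have "of_real (norm a) * (a - z) - a * (1 - cnj a * z)
      = of_real (norm a) * a - of_real (norm a) * z - a + (cnj a * a) * z"
    by (simp add: algebra_simps)
  also have "\<dots> = - of_real (1 - norm a) * (a + of_real (norm a) * z)"
    unfolding * by (simp add: algebra_simps)
  finally have "norm (blaschke_factor a z - 1)
      = (1 - norm a) * norm (a + of_real (norm a) * z) / (norm a * norm (1 - cnj a * z))"
    using assms(2) by (simp add: norm_mult norm_divide del: of_real_diff)
  also have "\<dots> \<le> (1 - norm a) * (norm a * 2) / (norm a * (1 - r))"
  proof (intro frac_le mult_left_mono)
    have "norm (a + of_real (norm a) * z) \<le> norm a + norm a * norm z"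
      using norm_triangle_ineq[of a "of_real (norm a) * z"] by (simp add: norm_mult)
    also have "\<dots> \<le> norm a * 2" using mult_left_mono[of "norm z" 1 "norm a"] assms by simp
    finally show "norm (a + of_real (norm a) * z) \<le> norm a * 2" .
    have "norm (cnj a * z) \<le> 1 * r" unfolding norm_mult
      using assms by (intro mult_mono) auto
    then show "1 - r \<le> norm (1 - cnj a * z)"
      using norm_triangle_ineq2[of 1 "cnj a * z"] by simp
  qed (use assms in auto)
  also have "\<dots> = 2 / (1 - r) * (1 - norm a)" using assms(1) by simp
  finally show ?thesis .
qed

lemma non_zero_near:
  assumes "f holomorphic_on unit_disk" "\<exists>z\<in>unit_disk. f z \<noteq> 0" "w \<in> unit_disk"
  shows "\<forall>\<^sub>F z in at w. f z \<noteq> 0"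
proof -
  obtain \<beta> where "\<beta> \<in> unit_disk" "f \<beta> \<noteq> 0" using assms(2) by blast
  then have "\<forall>\<^sub>F z in at w. f z \<noteq> 0 \<and> z \<in> unit_disk"
    by (intro non_zero_neighbour_alt[OF assms(1) _ _ assms(3)]) auto
  then show ?thesis by eventually_elim auto
qed

lemma zorder_mult_disk:
  assumes "f holomorphic_on unit_disk" "\<exists>z\<in>unit_disk. f z \<noteq> 0"
    and "g holomorphic_on unit_disk" "\<exists>z\<in>unit_disk. g z \<noteq> 0" and w: "w \<in> unit_disk"
  shows "zorder (\<lambda>z. f z * g z) w = zorder f w + zorder g w"
proof (rule zorder_times_analytic)
  show "f analytic_on {w}" "g analytic_on {w}"
    using assms holomorphic_on_imp_analytic_at by blast+
  show "\<forall>\<^sub>F z in at w. f z * g z \<noteq> 0"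
    using non_zero_near[OF assms(1,2) w] non_zero_near[OF assms(3,4) w] by eventually_elim auto
qed

lemma zorder_nonzero_disk:
  "f holomorphic_on unit_disk \<Longrightarrow> w \<in> unit_disk \<Longrightarrow> f w \<noteq> 0 \<Longrightarrow> zorder f w = 0"
  using holomorphic_on_imp_analytic_at by (blast intro: zorder_eq_0I)

lemma zorder_cong_disk:
  assumes "\<And>z. z \<in> unit_disk \<Longrightarrow> f z = g z" "w \<in> unit_disk"
  shows "zorder f w = zorder g w"
proof (rule zorder_cong)
  show "\<forall>\<^sub>F z in at w. f z = g z"
    using eventually_at_in_open'[OF open_ball assms(2)] by eventually_elim (rule assms(1))
qed simp

lemma zorder_blaschke_factor:
  assumes "a \<noteq> 0" "norm a < 1"
  shows "zorder (blaschke_factor a) a = 1"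
proof (rule zorder_eqI[of unit_disk _ "\<lambda>z. - of_real (norm a) / a / (1 - cnj a * z)"])
  show "blaschke_factor a w = - of_real (norm a) / a / (1 - cnj a * w) * (w - a) powi 1" for w
    by (simp add: blaschke_factor_def divide_inverse algebra_simps)
qed (use assms moebius_denominator_nonzero[OF assms(2)] in \<open>auto intro!: holomorphic_intros\<close>)

text \<open>
  The convergence condition is split off into a second locale because finite partial products are
  already needed in order to prove it for the zeros of a bounded function.
\<close>
locale disk_sequence =
  fixes N :: enat and a :: "nat \<Rightarrow> complex"
  assumes in_disk: "enat i < N \<Longrightarrow> a i \<in> unit_disk - {0}"
begin

text \<open>
  Indices beyond the length \<open>N\<close> contribute the factor 1 and the defect 0, so that all products and
  sums range over the natural numbers.
\<close>
definition factor :: "nat \<Rightarrow> complex \<Rightarrow> complex" where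
  "factor i z = (if enat i < N then blaschke_factor (a i) z else 1)"

definition defect :: "nat \<Rightarrow> real" where
  "defect i = (if enat i < N then 1 - norm (a i) else 0)"

definition partial :: "nat \<Rightarrow> complex \<Rightarrow> complex" where
  "partial n z = (\<Prod>i<n. factor i z)"

lemma defect_nonneg: "0 \<le> defect i"
  using in_disk[of i] by (auto simp: defect_def)

lemma factor_holomorphic: "factor i holomorphic_on unit_disk"
  using in_disk[of i] blaschke_factor_holomorphic[of "a i"]
  by (cases "enat i < N") (auto simp: factor_def[abs_def])

lemma continuous_on_factor: "continuous_on (cball 0 1) (factor i)"
  using in_disk[of i] continuous_on_blaschke_factor[of "a i"]
  by (cases "enat i < N") (auto simp: factor_def[abs_def])

lemma norm_factor_le_1: "norm z \<le> 1 \<Longrightarrow> norm (factor i z) \<le> 1"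
  using in_disk[of i] norm_blaschke_factor_le_1[of "a i" z] by (auto simp: factor_def)

lemma norm_factor_eq_1: "norm z = 1 \<Longrightarrow> norm (factor i z) = 1"
  using in_disk[of i] norm_blaschke_factor_eq_1[of "a i" z] by (auto simp: factor_def)

lemma factor_eq_0_iff: "norm z \<le> 1 \<Longrightarrow> factor i z = 0 \<longleftrightarrow> enat i < N \<and> a i = z"
  using in_disk[of i] blaschke_factor_eq_0_iff[of "a i" z] by (auto simp: factor_def)

lemma norm_factor_0: "norm (factor i 0) = 1 - defect i"
  using in_disk[of i] by (auto simp: factor_def defect_def norm_blaschke_factor)

lemma norm_factor_minus_1_le:
  "norm z \<le> r \<Longrightarrow> r < 1 \<Longrightarrow> norm (factor i z - 1) \<le> 2 / (1 - r) * defect i"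
  using in_disk[of i] norm_blaschke_factor_minus_1_le[of "a i" z r]
  by (auto simp: factor_def defect_def)

lemma zorder_factor:
  assumes "w \<in> unit_disk"
  shows "zorder (factor i) w = (if enat i < N \<and> a i = w then 1 else 0)"
proof (cases "enat i < N \<and> a i = w")
  case True
  then show ?thesis using in_disk[of i] zorder_blaschke_factor[of w]
    by (auto simp: factor_def[abs_def])
next
  case False
  then show ?thesis using zorder_nonzero_disk[OF factor_holomorphic assms] factor_eq_0_iff[of w i] assms by auto
qed

lemma partial_holomorphic: "partial n holomorphic_on unit_disk"
  unfolding partial_def[abs_def] by (intro holomorphic_intros factor_holomorphic)

lemma continuous_on_partial: "continuous_on (cball 0 1) (partial n)"
  unfolding partial_def[abs_def] by (intro continuous_intros continuous_on_factor)

lemma norm_partial_eq_1: "norm z = 1 \<Longrightarrow> norm (partial n z) = 1"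
  by (simp add: partial_def prod_norm[symmetric] norm_factor_eq_1)

lemma norm_partial_le_1: "norm z \<le> 1 \<Longrightarrow> norm (partial n z) \<le> 1"
  by (simp add: partial_def prod_norm[symmetric] norm_factor_le_1 prod_le_1)

lemma partial_0_nonzero: "partial n 0 \<noteq> 0"
  using factor_eq_0_iff[of 0] in_disk by (auto simp: partial_def)

lemma zorder_partial:
  assumes "w \<in> unit_disk"
  shows "zorder (partial n) w = int (card {i. i < n \<and> enat i < N \<and> a i = w})"
proof -
  have "zorder (partial n) w = (\<Sum>i<n. zorder (factor i) w)"
    unfolding partial_def[abs_def]
  proof (rule zorder_prod_analytic)
    show "factor i analytic_on {w}" for i
      using assms factor_holomorphic holomorphic_on_imp_analytic_at by blast
    have "\<exists>z\<in>unit_disk. partial n z \<noteq> 0" using partial_0_nonzero by (intro bexI[of _ 0]) auto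
    then show "\<forall>\<^sub>F z in at w. (\<Prod>i<n. factor i z) \<noteq> 0"
      using non_zero_near[OF partial_holomorphic _ assms] by (simp add: partial_def)
  qed
  also have "\<dots> = (\<Sum>i<n. int (if enat i < N \<and> a i = w then 1 else 0))"
    using zorder_factor[OF assms] by (intro sum.cong) auto
  also have "\<dots> = int (card {i. i < n \<and> enat i < N \<and> a i = w})"
    unfolding of_nat_sum[symmetric] by (simp add: sum.If_cases Int_def)
  finally show ?thesis .
qed

end

locale blaschke_sequence = disk_sequence +
  assumes summable_defect: "summable defect"
begin

definition tail :: "nat \<Rightarrow> complex \<Rightarrow> complex" where
  "tail n z = (\<Prod>i. factor (i + n) z)"

lemma summable_factor_minus_1:
  assumes "norm z < 1"
  shows "summable (\<lambda>i. norm (factor (i + n) z - 1))"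
proof (rule summable_comparison_test')
  show "summable (\<lambda>i. 2 / (1 - norm z) * defect (i + n))"
    using summable_defect by (intro summable_mult summable_ignore_initial_segment)
  show "norm (norm (factor (i + n) z - 1)) \<le> 2 / (1 - norm z) * defect (i + n)" for i
    using norm_factor_minus_1_le[of z "norm z" "i + n"] assms by simp
qed

lemma convergent_prod_factor: "norm z < 1 \<Longrightarrow> convergent_prod (\<lambda>i. factor (i + n) z)"
  using summable_factor_minus_1[of z n] abs_convergent_prod_imp_convergent_prod
    abs_convergent_prod_conv_summable by blast

lemma tail_LIMSEQ:
  assumes "norm z < 1"
  shows "(\<lambda>k. \<Prod>i<k. factor (i + n) z) \<longlonglongrightarrow> tail n z"
proof -
  have "(\<lambda>k. \<Prod>i<Suc k. factor (i + n) z) \<longlonglongrightarrow> tail n z"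
    using convergent_prod_LIMSEQ[OF convergent_prod_factor[OF assms, of n]]
    unfolding tail_def lessThan_Suc_atMost .
  then show ?thesis by (rule LIMSEQ_imp_Suc)
qed

lemma tail_split: "norm z < 1 \<Longrightarrow> tail 0 z = partial n z * tail n z"
  using has_prod_unique[OF has_prod_ignore_initial_segment'[OF convergent_prod_factor[of z 0], of n]]
  by (simp add: tail_def partial_def)

lemma norm_tail_le_1:
  assumes "norm z < 1"
  shows "norm (tail n z) \<le> 1"
proof (rule Lim_bounded)
  show "(\<lambda>k. norm (\<Prod>i<k. factor (i + n) z)) \<longlonglongrightarrow> norm (tail n z)"
    by (intro tendsto_norm tail_LIMSEQ assms)
  show "\<forall>k\<ge>0. norm (\<Prod>i<k. factor (i + n) z) \<le> 1"
    using assms by (simp add: prod_norm[symmetric] norm_factor_le_1 prod_le_1)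
qed

lemma tail_holomorphic: "tail n holomorphic_on unit_disk"
proof (rule holomorphic_uniform_sequence)
  show "(\<lambda>z. \<Prod>i<k. factor (i + n) z) holomorphic_on unit_disk" for k
    by (intro holomorphic_intros factor_holomorphic)
  fix x :: complex assume x: "x \<in> unit_disk"
  define r where "r = (1 + norm x) / 2"
  have r: "r < 1" "norm x < r" "0 < r"
    using x norm_ge_zero[of x] by (auto simp: r_def simp del: norm_ge_zero)
  have "uniformly_convergent_on (cball 0 r) (\<lambda>k z. \<Prod>i<k. factor (i + n) z)"
  proof (rule uniformly_convergent_on_prod')
    show "continuous_on (cball 0 r) (factor (i + n))" for i
      using r by (intro continuous_on_subset[OF continuous_on_factor]) auto
    show "uniformly_convergent_on (cball 0 r) (\<lambda>k z. \<Sum>i<k. norm (factor (i + n) z - 1))"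
    proof (rule Weierstrass_m_test')
      show "summable (\<lambda>i. 2 / (1 - r) * defect (i + n))"
        using summable_defect by (intro summable_mult summable_ignore_initial_segment)
      show "norm (norm (factor (i + n) z - 1)) \<le> 2 / (1 - r) * defect (i + n)" if "z \<in> cball 0 r" for i z
        using norm_factor_minus_1_le[of z r "i + n"] r that by simp
    qed
  qed auto
  then obtain g where g: "uniform_limit (cball 0 r) (\<lambda>k z. \<Prod>i<k. factor (i + n) z) g sequentially"
    by (auto simp: uniformly_convergent_on_def)
  have "g z = tail n z" if "z \<in> cball 0 r" for z
    using tendsto_uniform_limitI[OF g that] tail_LIMSEQ[of z n] r that
    by (intro LIMSEQ_unique) auto
  then have "uniform_limit (cball 0 r) (\<lambda>k z. \<Prod>i<k. factor (i + n) z) (tail n) sequentially"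
    using uniform_limit_cong'[of "cball 0 r" _ _ g "tail n"] g by fastforce
  moreover have sub: "cball x (r - norm x) \<subseteq> cball 0 r"
    by (simp add: cball_subset_cball_iff)
  ultimately show "\<exists>d>0. cball x d \<subseteq> unit_disk \<and>
      uniform_limit (cball x d) (\<lambda>k z. \<Prod>i<k. factor (i + n) z) (tail n) sequentially"
    using r by (intro exI[of _ "r - norm x"]) (auto intro: uniform_limit_on_subset)
qed simp

text \<open>
  Expanding the product bounds \<open>|tail n z - 1|\<close> by \<open>exp s - 1\<close>, where \<open>s\<close> is a remainder of the
  convergent series of defects up to a constant depending on \<open>z\<close>.
\<close>
lemma tail_tendsto_1:
  assumes "norm z < 1"
  shows "(\<lambda>n. tail n z) \<longlonglongrightarrow> 1"
proof -
  let ?c = "2 / (1 - norm z)"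
  define s where "s n = suminf defect - (\<Sum>i<n. defect i)" for n
  have s: "(\<Sum>i<k. defect (i + n)) \<le> s n" for k n
  proof -
    have "(\<Sum>i<k. defect (i + n)) \<le> (\<Sum>i. defect (i + n))"
      using summable_defect defect_nonneg by (intro sum_le_suminf summable_ignore_initial_segment) auto
    then show ?thesis using suminf_minus_initial_segment[OF summable_defect] by (simp add: s_def)
  qed
  have le: "norm (tail n z - 1) \<le> exp (?c * s n) - 1" for n
  proof (rule Lim_bounded)
    show "(\<lambda>k. norm ((\<Prod>i<k. factor (i + n) z) - 1)) \<longlonglongrightarrow> norm (tail n z - 1)"
      by (intro tendsto_intros tail_LIMSEQ assms)
    have "norm ((\<Prod>i<k. factor (i + n) z) - 1) \<le> exp (?c * s n) - 1" for k
    proof -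
      have "norm ((\<Prod>i<k. 1 + (factor (i + n) z - 1)) - 1) \<le> (\<Prod>i<k. 1 + norm (factor (i + n) z - 1)) - 1"
        by (rule norm_prod_minus1_le_prod_minus1)
      also have "\<dots> \<le> exp (\<Sum>i<k. norm (factor (i + n) z - 1)) - 1"
        using prod_le_exp_sum[of "{..<k}" "\<lambda>i. norm (factor (i + n) z - 1)"] by simp
      also have "\<dots> \<le> exp (?c * s n) - 1"
      proof -
        have "(\<Sum>i<k. norm (factor (i + n) z - 1)) \<le> (\<Sum>i<k. ?c * defect (i + n))"
          using norm_factor_minus_1_le[of z "norm z"] assms by (intro sum_mono) auto
        also have "\<dots> = ?c * (\<Sum>i<k. defect (i + n))" by (rule sum_distrib_left[symmetric])
        also have "\<dots> \<le> ?c * s n" using s assms by (intro mult_left_mono) auto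
        finally show ?thesis by simp
      qed
      finally show ?thesis by simp
    qed
    then show "\<forall>k\<ge>0. norm ((\<Prod>i<k. factor (i + n) z) - 1) \<le> exp (?c * s n) - 1" by blast
  qed
  have "s \<longlonglongrightarrow> suminf defect - suminf defect"
    unfolding s_def[abs_def] by (intro tendsto_intros summable_LIMSEQ summable_defect)
  then have "(\<lambda>n. exp (?c * s n) - 1) \<longlonglongrightarrow> exp (?c * 0) - 1"
    by (intro tendsto_intros) simp
  then have "(\<lambda>n. exp (?c * s n) - 1) \<longlonglongrightarrow> 0" by simp
  then have "(\<lambda>n. tail n z - 1) \<longlonglongrightarrow> 0"
    by (rule Lim_null_comparison[rotated]) (use le in auto)
  then show ?thesis by (rule LIM_zero_cancel)
qed

lemma tail_nonzero:
  assumes "norm z < 1" "\<And>i. n \<le> i \<Longrightarrow> enat i < N \<Longrightarrow> a i \<noteq> z"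
  shows "tail n z \<noteq> 0"
  unfolding tail_def using assms factor_eq_0_iff[of z]
  by (intro prodinf_nonzero convergent_prod_factor) auto

lemma tail_0_nonzero: "tail 0 0 \<noteq> 0"
  using in_disk by (intro tail_nonzero) auto

text \<open>
  The defects tend to 0, so the zeros accumulate only at the circle.
\<close>
lemma zeros_bounded:
  assumes "norm w < 1"
  obtains n where "\<And>i. n \<le> i \<Longrightarrow> enat i < N \<Longrightarrow> a i \<noteq> w"
proof -
  have "defect \<longlonglongrightarrow> 0" by (rule summable_LIMSEQ_zero[OF summable_defect])
  then have "\<forall>\<^sub>F i in sequentially. defect i < 1 - norm w"
    by (rule order_tendstoD) (use assms in auto)
  then obtain n where "\<And>i. n \<le> i \<Longrightarrow> defect i < 1 - norm w"
    by (auto simp: eventually_sequentially)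
  note n = this
  have "a i \<noteq> w" if "n \<le> i" "enat i < N" for i
    using n[OF that(1)] that(2) by (auto simp: defect_def)
  then show ?thesis by (rule that)
qed

text \<open>
  A tail beginning after the last occurrence of \<open>w\<close> does not vanish at \<open>w\<close>; the remaining finite
  product has one simple zero for each occurrence.
\<close>
lemma zorder_tail_0:
  assumes "w \<in> unit_disk"
  shows "zorder (tail 0) w = int (card {i. enat i < N \<and> a i = w})"
proof -
  obtain n where n: "\<And>i. n \<le> i \<Longrightarrow> enat i < N \<Longrightarrow> a i \<noteq> w"
    using zeros_bounded[of w] assms by auto
  have nz: "tail n w \<noteq> 0" using n assms by (intro tail_nonzero) auto
  have "zorder (tail 0) w = zorder (\<lambda>z. partial n z * tail n z) w"
    using assms by (intro zorder_cong_disk tail_split) auto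
  also have "\<dots> = zorder (partial n) w + zorder (tail n) w"
    using partial_0_nonzero nz assms
    by (intro zorder_mult_disk partial_holomorphic tail_holomorphic) (auto intro: bexI[of _ 0])
  also have "zorder (tail n) w = 0"
    by (intro zorder_nonzero_disk tail_holomorphic assms nz)
  also have "{i. i < n \<and> enat i < N \<and> a i = w} = {i. enat i < N \<and> a i = w}"
  proof -
    have "i < n" if "enat i < N" "a i = w" for i using n[of i] that by (cases "i < n") auto
    then show ?thesis by blast
  qed
  then have "zorder (partial n) w = int (card {i. enat i < N \<and> a i = w})"
    using zorder_partial[OF assms, of n] by simp
  finally show ?thesis by simp
qed

end

text \<open>
  Connects the definition with the locale in which the products were studied.
\<close>
lemma blaschke_product_iff:
  "blaschke_product B \<longleftrightarrow> (\<exists>\<gamma> m N a. norm \<gamma> = 1 \<and> blaschke_sequence N a \<and>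
     (\<forall>z\<in>unit_disk. B z = \<gamma> * z ^ m * blaschke_sequence.tail N a 0 z))"
proof -
  have 1: "blaschke_sequence N a \<longleftrightarrow> (\<forall>i. enat i < N \<longrightarrow> a i \<in> unit_disk - {0}) \<and>
      summable (\<lambda>i. if enat i < N then 1 - cmod (a i) else 0)" for N a
  proof (cases "disk_sequence N a")
    case True
    then show ?thesis
      unfolding blaschke_sequence_def blaschke_sequence_axioms_def
      by (simp add: disk_sequence.defect_def[OF True, abs_def] disk_sequence_def)
  next
    case False
    then show ?thesis by (auto simp: blaschke_sequence_def disk_sequence_def)
  qed
  have 2: "blaschke_sequence.tail N a 0 z = (\<Prod>i. if enat i < N then blaschke_factor (a i) z else 1)"
    if "blaschke_sequence N a" for N a z
  proof -
    interpret blaschke_sequence N a by fact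
    show ?thesis by (simp add: tail_def factor_def)
  qed
  have "(cmod \<gamma> = 1 \<and> (\<forall>i. enat i < N \<longrightarrow> a i \<in> unit_disk - {0}) \<and>
     summable (\<lambda>i. if enat i < N then 1 - cmod (a i) else 0) \<and>
     (\<forall>z\<in>unit_disk.
        B z = \<gamma> * z ^ m * (\<Prod>i. if enat i < N then blaschke_factor (a i) z else 1))) \<longleftrightarrow>
     (norm \<gamma> = 1 \<and> blaschke_sequence N a \<and>
     (\<forall>z\<in>unit_disk. B z = \<gamma> * z ^ m * blaschke_sequence.tail N a 0 z))" for \<gamma> m N a
    unfolding 1 using 2[of N a] 1[of N a] by (simp cong: conj_cong)
  then show ?thesis unfolding blaschke_product_def by (simp only:)
qed

section \<open>Division by Blaschke products\<close>

text \<open>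
  The only features of a Blaschke product needed for division and for radial limits: it splits
  into a factor that is continuous and unimodular up to the boundary and a contractive tail that
  tends to 1.
\<close>
lemma blaschke_product_approx:
  assumes "blaschke_product B"
  obtains P T :: "nat \<Rightarrow> complex \<Rightarrow> complex" where
    "\<And>n. continuous_on (cball 0 1) (P n)" "\<And>n. P n holomorphic_on unit_disk"
    "\<And>n z. norm z = 1 \<Longrightarrow> norm (P n z) = 1" "\<And>n z. norm z \<le> 1 \<Longrightarrow> norm (P n z) \<le> 1"
    "\<And>n. T n holomorphic_on unit_disk" "\<And>n z. norm z < 1 \<Longrightarrow> norm (T n z) \<le> 1"
    "\<And>z. norm z < 1 \<Longrightarrow> (\<lambda>n. T n z) \<longlonglongrightarrow> 1"
    "\<And>n z. norm z < 1 \<Longrightarrow> B z = P n z * T n z"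
proof -
  obtain \<gamma> m N a where *: "norm \<gamma> = 1" "blaschke_sequence N a"
    "\<And>z. z \<in> unit_disk \<Longrightarrow> B z = \<gamma> * z ^ m * blaschke_sequence.tail N a 0 z"
    using assms unfolding blaschke_product_iff by blast
  interpret blaschke_sequence N a by fact
  define P where "P n z = \<gamma> * z ^ m * partial n z" for n z
  show ?thesis
  proof (rule that[of P tail])
    show "continuous_on (cball 0 1) (P n)" for n
      unfolding P_def by (intro continuous_intros continuous_on_partial)
    show "P n holomorphic_on unit_disk" for n
      unfolding P_def by (intro holomorphic_intros partial_holomorphic)
    show "norm (P n z) = 1" if "norm z = 1" for n z
      using that *(1) by (simp add: P_def norm_mult norm_power norm_partial_eq_1)
    show "norm (P n z) \<le> 1" if "norm z \<le> 1" for n z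
    proof -
      have "norm z ^ m * norm (partial n z) \<le> 1"
        using norm_partial_le_1[OF that, of n] power_le_one[of "norm z" m] that by (intro mult_le_one) auto
      then show ?thesis using *(1) by (simp add: P_def norm_mult norm_power)
    qed
    show "B z = P n z * tail n z" if "norm z < 1" for n z
      using *(3)[of z] tail_split[OF that, of n] that by (simp add: P_def)
  qed (fact tail_holomorphic norm_tail_le_1 tail_tendsto_1)+
qed

lemma blaschke_product_holomorphic:
  assumes "blaschke_product B"
  shows "B holomorphic_on unit_disk"
proof -
  obtain P T :: "nat \<Rightarrow> complex \<Rightarrow> complex" where
    *: "\<And>n. P n holomorphic_on unit_disk" "\<And>n. T n holomorphic_on unit_disk"
       "\<And>n z. norm z < 1 \<Longrightarrow> B z = P n z * T n z"
    using blaschke_product_approx[OF assms] by metis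
  have "(\<lambda>z. P 0 z * T 0 z) holomorphic_on unit_disk" by (intro holomorphic_intros *)
  then show ?thesis by (rule holomorphic_transform) (use *(3)[of _ 0] in auto)
qed

lemma norm_blaschke_product_le_1:
  assumes "blaschke_product B" "norm z < 1"
  shows "norm (B z) \<le> 1"
proof -
  obtain P T :: "nat \<Rightarrow> complex \<Rightarrow> complex" where
    *: "\<And>n z. norm z \<le> 1 \<Longrightarrow> norm (P n z) \<le> 1" "\<And>n z. norm z < 1 \<Longrightarrow> norm (T n z) \<le> 1"
       "\<And>n z. norm z < 1 \<Longrightarrow> B z = P n z * T n z"
    using blaschke_product_approx[OF assms(1)] by metis
  show ?thesis using *(1)[of z 0] *(2,3)[OF assms(2), of 0] assms(2)
    by (simp add: norm_mult mult_le_one)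
qed

lemma blaschke_product_nonzero:
  assumes "blaschke_product B"
  shows "\<exists>z\<in>unit_disk. B z \<noteq> 0"
proof -
  obtain \<gamma> m N a where *: "norm \<gamma> = 1" "blaschke_sequence N a"
    "\<And>z. z \<in> unit_disk \<Longrightarrow> B z = \<gamma> * z ^ m * blaschke_sequence.tail N a 0 z"
    using assms unfolding blaschke_product_iff by blast
  interpret blaschke_sequence N a by fact
  have "\<forall>\<^sub>F z in at 0. tail 0 z \<noteq> 0"
    using tail_0_nonzero by (intro non_zero_near tail_holomorphic) (auto intro: bexI[of _ 0])
  moreover have "\<forall>\<^sub>F z in at (0::complex). z \<noteq> 0 \<and> z \<in> unit_disk"
    using eventually_at_ball'[OF zero_less_one, of "0::complex" UNIV] by eventually_elim auto
  ultimately have "\<forall>\<^sub>F z in at (0::complex). z \<in> unit_disk \<and> z \<noteq> 0 \<and> tail 0 z \<noteq> 0"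
    by eventually_elim auto
  then obtain z where "z \<in> unit_disk" "z \<noteq> 0" "tail 0 z \<noteq> 0"
    using eventually_happens[of _ "at (0::complex)"] by auto
  then show ?thesis using *(1) *(3)[of z] by (intro bexI[of _ z]) auto
qed

text \<open>
  The functions \<open>T n * q\<close> are quotients by finite products and tend to \<open>q\<close>.
\<close>
lemma norm_divide_blaschke_le:
  assumes B: "blaschke_product B" and q: "q holomorphic_on unit_disk" and w: "norm w < 1"
    and M: "\<And>z. norm z < 1 \<Longrightarrow> norm (B z * q z) \<le> M"
  shows "norm (q w) \<le> M"
proof -
  obtain P T :: "nat \<Rightarrow> complex \<Rightarrow> complex" where
    P: "\<And>n. continuous_on (cball 0 1) (P n)" "\<And>n z. norm z = 1 \<Longrightarrow> norm (P n z) = 1" and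
    T: "\<And>n. T n holomorphic_on unit_disk" "\<And>z. norm z < 1 \<Longrightarrow> (\<lambda>n. T n z) \<longlonglongrightarrow> 1" and
    BPT: "\<And>n z. norm z < 1 \<Longrightarrow> B z = P n z * T n z"
    using blaschke_product_approx[OF B] by metis
  have "norm (T n w * q w) \<le> M" for n
  proof (rule norm_divide_unimodular_le[OF P(1,2) _ w])
    show "(\<lambda>z. T n z * q z) holomorphic_on unit_disk" by (intro holomorphic_intros T q)
    show "norm (P n z * (T n z * q z)) \<le> M" if "norm z < 1" for z
      using M[OF that] BPT[OF that, of n] by (simp add: mult.assoc)
  qed
  moreover have "(\<lambda>n. norm (T n w * q w)) \<longlonglongrightarrow> norm (1 * q w)"
    by (intro tendsto_intros T w)
  ultimately show ?thesis using LIMSEQ_le_const2 by fastforce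
qed

text \<open>
  F. Riesz's division theorem. With \<open>B = P n * T n\<close>, the means of \<open>T n * q\<close> are bounded by those of
  \<open>B * q\<close> because \<open>P n\<close> is unimodular on the circle; dominated convergence, with \<open>q\<close> itself
  as the dominating function, passes to the limit.
\<close>
lemma hardy_space_divide_blaschke:
  assumes B: "blaschke_product B" and q: "q holomorphic_on unit_disk" and p: "0 < p"
    and Bq: "(\<lambda>z. B z * q z) \<in> hardy_space p"
  shows "q \<in> hardy_space p"
proof -
  obtain P T :: "nat \<Rightarrow> complex \<Rightarrow> complex" where
    P: "\<And>n. continuous_on (cball 0 1) (P n)" "\<And>n. P n holomorphic_on unit_disk"
       "\<And>n z. norm z = 1 \<Longrightarrow> norm (P n z) = 1" and "\<And>n z. norm z \<le> 1 \<Longrightarrow> norm (P n z) \<le> 1" and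
    T: "\<And>n. T n holomorphic_on unit_disk" "\<And>n z. norm z < 1 \<Longrightarrow> norm (T n z) \<le> 1"
       "\<And>z. norm z < 1 \<Longrightarrow> (\<lambda>n. T n z) \<longlonglongrightarrow> 1" and
    BPT: "\<And>n z. norm z < 1 \<Longrightarrow> B z = P n z * T n z"
    using blaschke_product_approx[OF B] by metis
  obtain M where M: "\<And>r. r \<in> {0<..<1} \<Longrightarrow> power_mean_integral p (\<lambda>z. B z * q z) r \<le> M"
    using Bq unfolding hardy_space_iff by blast
  have "power_mean_integral p q r \<le> M" if r: "r \<in> {0<..<1}" for r
  proof (rule LIMSEQ_le_const2)
    have "power_mean_integral p (\<lambda>z. T n z * q z) r \<le> M" for n
    proof (rule power_mean_divide_unimodular[OF P(1,3,2)])
      fix R :: real assume R: "0 < R" "R < 1"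
      have eq: "B (of_real R * cis t) * q (of_real R * cis t) = P n (of_real R * cis t) * (T n (of_real R * cis t) * q (of_real R * cis t))" for t
        using BPT[of "of_real R * cis t" n] R by simp
      then show "power_mean_integral p (\<lambda>z. P n z * (T n z * q z)) R \<le> M"
        unfolding power_mean_integral_def eq[symmetric] using M[of R] R by (simp add: power_mean_integral_def)
    qed (use r p q T in \<open>auto intro!: holomorphic_intros\<close>)
    then show "\<exists>N. \<forall>n\<ge>N. power_mean_integral p (\<lambda>z. T n z * q z) r \<le> M" by blast
    show "(\<lambda>n. power_mean_integral p (\<lambda>z. T n z * q z) r) \<longlonglongrightarrow> power_mean_integral p q r"
      unfolding power_mean_integral_def
    proof (rule dominated_convergence(2))
      show "(\<lambda>t. norm (T n (of_real r * cis t) * q (of_real r * cis t)) powr p) integrable_on {0..2 * pi}" for n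
        using r p by (intro integrable_continuous_real continuous_on_circle_powr holomorphic_intros T q) auto
      show "(\<lambda>t. norm (q (of_real r * cis t)) powr p) integrable_on {0..2 * pi}"
        using r p by (intro integrable_continuous_real continuous_on_circle_powr q) auto
      fix n t
      have "norm (T n (of_real r * cis t)) * norm (q (of_real r * cis t)) \<le> 1 * norm (q (of_real r * cis t))"
        using T(2)[of "of_real r * cis t" n] r by (intro mult_right_mono) auto
      then show "norm (norm (T n (of_real r * cis t) * q (of_real r * cis t)) powr p) \<le> norm (q (of_real r * cis t)) powr p"
        using p by (auto simp: norm_mult intro!: powr_mono2)
    next
      fix t :: real
      have "(\<lambda>n. norm (T n (of_real r * cis t) * q (of_real r * cis t)) powr p)
          \<longlonglongrightarrow> norm (1 * q (of_real r * cis t)) powr p"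
        using r p by (intro tendsto_powr2 tendsto_intros T) auto
      then show "(\<lambda>n. norm (T n (of_real r * cis t) * q (of_real r * cis t)) powr p)
          \<longlonglongrightarrow> norm (q (of_real r * cis t)) powr p"
        by simp
    qed
  qed
  then show ?thesis unfolding hardy_space_iff using q by blast
qed

section \<open>A radial maximal inequality\<close>

lemma integral_symmetric_interval:
  fixes h :: "real \<Rightarrow> real"
  assumes h: "continuous_on UNIV h" and \<delta>: "0 \<le> \<delta>"
  shows "integral {t - \<delta>..t + \<delta>} h = integral {0..\<delta>} (\<lambda>x. h (t + x) + h (t - x))"
proof -
  have int: "(\<lambda>x. h (g x)) integrable_on {a..b}" if "continuous_on UNIV g" for a b :: real and g
    by (intro integrable_continuous_real continuous_on_compose2[OF h continuous_on_subset[OF that]]) auto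
  have "integral {t - \<delta>..t + \<delta>} h = integral {t - \<delta>..t} h + integral {t..t + \<delta>} h"
    using \<delta> int[OF continuous_on_id]
    by (intro Henstock_Kurzweil_Integration.integral_combine[symmetric]) auto
  also have "integral {t..t + \<delta>} h = integral {0..\<delta>} (\<lambda>x. h (t + x))"
    using integral_shift_Icc_real[of 0 \<delta> h t] by (simp add: o_def add.commute)
  also have "integral {t - \<delta>..t} h = integral {-\<delta>..0} (\<lambda>x. h (t + x))"
    using integral_shift_Icc_real[of "-\<delta>" 0 h t] by (simp add: o_def add.commute)
  also have "\<dots> = integral {0..\<delta>} (\<lambda>x. h (t - x))"
    using Henstock_Kurzweil_Integration.integral_reflect_real[of \<delta> 0 "\<lambda>x. h (t - x)"] by simp
  also have "integral {0..\<delta>} (\<lambda>x. h (t - x)) + integral {0..\<delta>} (\<lambda>x. h (t + x))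
      = integral {0..\<delta>} (\<lambda>x. h (t - x) + h (t + x))"
    by (rule integral_add[symmetric]) (intro int continuous_intros)+
  finally show ?thesis by (simp add: add.commute)
qed

lemma poisson_kernel_of_real:
  "poisson_kernel (of_real r) x = (1 - r\<^sup>2) / (1 - 2 * r * cos x + r\<^sup>2)"
proof -
  have "(norm (cis x - of_real r))\<^sup>2 = (cos x)\<^sup>2 + (sin x)\<^sup>2 - 2 * r * cos x + r\<^sup>2"
    unfolding cmod_power2 by (simp add: power2_eq_square algebra_simps)
  then show ?thesis by (simp add: poisson_kernel_def)
qed

text \<open>
  The Poisson formula folded at the angle of the point, so that the kernel appears only on the
  interval where it is decreasing.
\<close>
lemma harmonic_symmetric_Poisson:
  assumes f: "f holomorphic_on ball 0 R" "1 < R" and r: "0 \<le> r" "r < 1"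
  shows "2 * pi * Re (f (of_real r * cis t))
    = integral {0..pi} (\<lambda>x. poisson_kernel (of_real r) x * (Re (f (cis (t + x))) + Re (f (cis (t - x)))))"
proof -
  \<comment> \<open>Rotating by \<open>t + pi\<close> moves the angle \<open>t\<close> to the centre \<open>pi\<close> of the interval of integration.\<close>
  define k where "k z = f (- (cis t * z))" for z
  have k: "k holomorphic_on ball 0 R"
    unfolding k_def
    by (intro holomorphic_on_compose_gen[OF _ f(1), unfolded o_def]) (auto intro!: holomorphic_intros simp: norm_mult)
  have ck: "continuous_on UNIV (\<lambda>s. k (cis s))"
    using f(2) by (intro continuous_on_compose2[OF holomorphic_on_imp_continuous_on[OF k]] continuous_intros) auto
  let ?h = "\<lambda>s. poisson_kernel (- of_real r) s * Re (k (cis s))"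
  have "((\<lambda>s. of_real (poisson_kernel (- of_real r) s) * k (cis s)) has_integral of_real (2 * pi) * k (- of_real r)) {0..2 * pi}"
    using r by (intro Poisson_formula[OF k f(2)]) auto
  from has_integral_Re[OF this]
  have "(?h has_integral 2 * pi * Re (f (of_real r * cis t))) {0..2 * pi}"
    unfolding Re_of_real_mult by (simp add: k_def mult.commute)
  then have "2 * pi * Re (f (of_real r * cis t)) = integral {pi - pi..pi + pi} ?h"
    by (simp add: integral_unique)
  also have "\<dots> = integral {0..pi} (\<lambda>x. ?h (pi + x) + ?h (pi - x))"
    using r by (intro integral_symmetric_interval)
      (auto intro!: continuous_intros continuous_on_poisson_kernel ck)
  also have "\<dots> = integral {0..pi} (\<lambda>x. poisson_kernel (of_real r) x * (Re (f (cis (t + x))) + Re (f (cis (t - x)))))"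
  proof (rule arg_cong[where f = "integral {0..pi}"], rule ext)
    fix x
    have "poisson_kernel (- of_real r) (pi + x) = poisson_kernel (of_real r) x"
      "poisson_kernel (- of_real r) (pi - x) = poisson_kernel (of_real r) x"
      using poisson_kernel_of_real[of "-r"] poisson_kernel_of_real[of r] by simp_all
    moreover have "k (cis (pi + x)) = f (cis (t + x))" "k (cis (pi - x)) = f (cis (t - x))"
      by (simp_all add: k_def cis_mult[symmetric] cis_divide[symmetric])
    ultimately show "?h (pi + x) + ?h (pi - x) = poisson_kernel (of_real r) x * (Re (f (cis (t + x))) + Re (f (cis (t - x))))"
      by (simp add: algebra_simps)
  qed
  finally show ?thesis .
qed

text \<open>
  A harmonic function on a radius is bounded by the largest average of its boundary values over
  intervals centred at the end of the radius. Since the Poisson kernel decreases away from the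
  centre, this is an integration by parts against the primitive of the boundary values.
\<close>
lemma harmonic_le_of_averages:
  assumes f: "f holomorphic_on ball 0 R" "1 < R" and r: "0 \<le> r" "r < 1"
    and avg: "\<And>\<delta>. 0 < \<delta> \<Longrightarrow> \<delta> \<le> pi \<Longrightarrow> integral {t - \<delta>..t + \<delta>} (\<lambda>s. Re (f (cis s))) \<le> 2 * c * \<delta>"
  shows "Re (f (of_real r * cis t)) \<le> c"
proof -
  let ?K = "poisson_kernel (of_real r)"
  define g where "g s = Re (f (cis s))" for s
  define G where "G s = integral {0..s} (\<lambda>x. g (t + x) + g (t - x)) - 2 * c * s" for s
  have cg: "continuous_on UNIV g" unfolding g_def
    using f(2) by (intro continuous_intros continuous_on_compose2[OF holomorphic_on_imp_continuous_on[OF f(1)]]) auto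
  have cg2: "continuous_on X (\<lambda>x. g (t + x) + g (t - x))" for X
    by (intro continuous_intros continuous_on_compose2[OF cg]) auto
  have G_le: "G s \<le> 0" if "0 \<le> s" "s \<le> pi" for s
  proof (cases "s = 0")
    case False
    then have "integral {t - s..t + s} g \<le> 2 * c * s" using avg[of s] that by (simp add: g_def[abs_def])
    then show ?thesis using integral_symmetric_interval[OF cg that(1), of t] by (simp add: G_def)
  qed (simp add: G_def)
  have G_deriv: "(G has_vector_derivative (g (t + s) + g (t - s) - 2 * c)) (at s within {0..pi})" if "s \<in> {0..pi}" for s
  proof -
    have "((\<lambda>s. 2 * c * s) has_vector_derivative 2 * c) (at s within {0..pi})"
      unfolding has_real_derivative_iff_has_vector_derivative[symmetric]
      by (auto intro!: derivative_eq_intros)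
    from has_vector_derivative_diff[OF integral_has_vector_derivative[OF cg2 that] this]
    show ?thesis unfolding G_def .
  qed
  define K' where "K' s = - ((1 - r\<^sup>2) * (2 * r * sin s) / (1 - 2 * r * cos s + r\<^sup>2)\<^sup>2)" for s
  have den: "1 - 2 * r * cos s + r\<^sup>2 \<noteq> 0" for s
  proof -
    have "2 * r * cos s \<le> 2 * r * 1" using r by (intro mult_left_mono) auto
    moreover have "(1 - r)\<^sup>2 > 0" using r by simp
    ultimately show ?thesis by (simp add: power2_eq_square algebra_simps)
  qed
  have den': "1 - r * (cos s * 2) + r * r \<noteq> 0" for s using den[of s] by (simp add: power2_eq_square mult_ac)
  have K_deriv: "(?K has_vector_derivative K' s) (at s within X)" for s X
    unfolding poisson_kernel_of_real[abs_def] K'_def has_real_derivative_iff_has_vector_derivative[symmetric]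
    by (auto intro!: derivative_eq_intros simp: den' power2_eq_square mult_ac)
  have K'_le: "K' s \<le> 0" if "0 \<le> s" "s \<le> pi" for s
    unfolding K'_def using that r sin_ge_zero[of s]
    by (auto simp: power_le_one intro!: divide_nonneg_nonneg mult_nonneg_nonneg)
  have K_nonneg: "?K s \<ge> 0" for s using r by (intro poisson_kernel_nonneg) auto
  \<comment> \<open>The second summand is nonnegative, as both \<open>K'\<close> and \<open>G\<close> are nonpositive.\<close>
  have 1: "((\<lambda>s. ?K s * (g (t + s) + g (t - s) - 2 * c) + K' s * G s) has_integral (?K pi * G pi - ?K 0 * G 0)) {0..pi}"
    by (rule fundamental_theorem_of_calculus) (auto intro!: has_vector_derivative_mult K_deriv G_deriv)
  have cK: "continuous_on X ?K" for X
    using r by (intro continuous_on_poisson_kernel continuous_intros) auto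
  have 2: "((\<lambda>s. ?K s * (g (t + s) + g (t - s) - 2 * c)) has_integral
      integral {0..pi} (\<lambda>s. ?K s * (g (t + s) + g (t - s) - 2 * c))) {0..pi}"
    by (intro integrable_integral integrable_continuous_real continuous_intros cK cg2)
  have "integral {0..pi} (\<lambda>s. ?K s * (g (t + s) + g (t - s) - 2 * c)) \<le> ?K pi * G pi - ?K 0 * G 0"
    by (rule has_integral_le[OF 2 1]) (use K'_le G_le in \<open>auto intro!: mult_nonpos_nonpos\<close>)
  also have "\<dots> \<le> 0" using G_le[of pi] K_nonneg[of pi] by (simp add: G_def mult_nonneg_nonpos)
  also have "integral {0..pi} (\<lambda>s. ?K s * (g (t + s) + g (t - s) - 2 * c))
     = integral {0..pi} (\<lambda>s. ?K s * (g (t + s) + g (t - s))) - c * integral {0..pi} (\<lambda>s. ?K s * (1 + 1))"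
  proof -
    have "integral {0..pi} (\<lambda>s. ?K s * (g (t + s) + g (t - s))) - integral {0..pi} (\<lambda>s. c * (?K s * (1 + 1)))
      = integral {0..pi} (\<lambda>s. ?K s * (g (t + s) + g (t - s)) - c * (?K s * (1 + 1)))"
      by (rule integral_diff[symmetric]; intro integrable_continuous_real continuous_intros cK cg2)
    then show ?thesis by (simp add: algebra_simps)
  qed
  also have "integral {0..pi} (\<lambda>s. ?K s * (1 + 1)) = 2 * pi"
    using harmonic_symmetric_Poisson[of "\<lambda>_. 1" 2 r] r by simp
  also have "integral {0..pi} (\<lambda>s. ?K s * (g (t + s) + g (t - s))) = 2 * pi * Re (f (of_real r * cis t))"
    using harmonic_symmetric_Poisson[OF f r, of t] by (simp add: g_def)
  finally have "2 * pi * Re (f (of_real r * cis t)) \<le> 2 * pi * c" by simp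
  then show ?thesis by (rule mult_left_le_imp_le) simp
qed

text \<open>
  The Hardy--Littlewood argument: by Vitali's covering lemma the intervals with large average can be
  thinned out to disjoint ones whose fivefold enlargements still cover.
\<close>
lemma weak_type_covering:
  fixes g :: "real \<Rightarrow> real"
  assumes g: "continuous_on UNIV g" "\<And>s. 0 \<le> g s" and c: "0 < c"
    and avg: "\<And>t. t \<in> E \<Longrightarrow> \<exists>\<delta>. 0 < \<delta> \<and> \<delta> \<le> d \<and> a \<le> t - \<delta> \<and> t + \<delta> \<le> b \<and> 2 * c * \<delta> < integral {t - \<delta>..t + \<delta>} g"
  obtains U where "U \<in> lmeasurable" "E \<subseteq> U" "measure lebesgue U \<le> 5 / c * integral {a..b} g"
proof -
  obtain \<delta> where \<delta>: "\<And>t. t \<in> E \<Longrightarrow> 0 < \<delta> t \<and> \<delta> t \<le> d" "\<And>t. t \<in> E \<Longrightarrow> a \<le> t - \<delta> t \<and> t + \<delta> t \<le> b"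
    "\<And>t. t \<in> E \<Longrightarrow> 2 * c * \<delta> t < integral {t - \<delta> t..t + \<delta> t} g"
    using avg by metis
  have int: "g integrable_on {u..v}" for u v
    by (intro integrable_continuous_real continuous_on_subset[OF g(1)]) auto
  have cover: "E \<subseteq> (\<Union>t\<in>E. cball t (\<delta> t))" using \<delta>(1) by fastforce
  obtain C where C: "countable C" "C \<subseteq> E" "pairwise (\<lambda>s t. disjnt (cball s (\<delta> s)) (cball t (\<delta> t))) C"
    "E \<subseteq> (\<Union>t\<in>C. cball t (5 * \<delta> t))"
    using Vitali_covering_lemma_cballs[OF cover \<delta>(1)] by blast
  have bound: "measure lebesgue (\<Union>t\<in>F. cball t (5 * \<delta> t)) \<le> 5 / c * integral {a..b} g" if F: "F \<subseteq> C" "finite F" for F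
  proof -
    have FE: "t \<in> E" if "t \<in> F" for t using that F C(2) by blast
    have "measure lebesgue (\<Union>t\<in>F. cball t (5 * \<delta> t)) \<le> (\<Sum>t\<in>F. measure lebesgue (cball t (5 * \<delta> t)))"
      using F by (intro measure_UNION_le) auto
    also have "\<dots> = (\<Sum>t\<in>F. 10 * \<delta> t)"
    proof (rule sum.cong)
      fix t assume "t \<in> F"
      then have "0 < \<delta> t" using \<delta>(1) FE by blast
      then show "measure lebesgue (cball t (5 * \<delta> t)) = 10 * \<delta> t" by (simp add: cball_eq_atLeastAtMost)
    qed simp
    also have "\<dots> \<le> (\<Sum>t\<in>F. 5 / c * integral (cball t (\<delta> t)) g)"
    proof (rule sum_mono)
      fix t assume "t \<in> F"
      then have "2 * c * \<delta> t < integral {t - \<delta> t..t + \<delta> t} g" using \<delta>(3) FE by blast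
      then show "10 * \<delta> t \<le> 5 / c * integral (cball t (\<delta> t)) g"
        using c by (simp add: cball_eq_atLeastAtMost field_simps)
    qed
    also have "\<dots> = 5 / c * (\<Sum>t\<in>F. integral (cball t (\<delta> t)) g)" by (rule sum_distrib_left[symmetric])
    also have "\<dots> \<le> 5 / c * integral {a..b} g"
    proof (rule mult_left_mono, rule has_integral_subset_le)
      show "(g has_integral (\<Sum>t\<in>F. integral (cball t (\<delta> t)) g)) (\<Union>t\<in>F. cball t (\<delta> t))"
      proof (rule has_integral_UN[OF F(2)])
        show "(g has_integral integral (cball t (\<delta> t)) g) (cball t (\<delta> t))" for t
          using int by (simp add: cball_eq_atLeastAtMost integrable_integral)
        show "pairwise (\<lambda>i i'. negligible (cball i (\<delta> i) \<inter> cball i' (\<delta> i'))) F"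
          using pairwise_subset[OF C(3) F(1)] by (auto simp: pairwise_def disjnt_def)
      qed
      show "(\<Union>t\<in>F. cball t (\<delta> t)) \<subseteq> {a..b}"
        using \<delta>(2) FE by (fastforce simp: cball_eq_atLeastAtMost)
    qed (use g(2) int c in \<open>auto intro: integrable_integral\<close>)
    finally show ?thesis .
  qed
  show ?thesis
  proof (rule that)
    show "(\<Union>t\<in>C. cball t (5 * \<delta> t)) \<in> lmeasurable"
      by (rule fmeasurable_UN_bound[OF C(1) _ bound]) auto
    show "measure lebesgue (\<Union>t\<in>C. cball t (5 * \<delta> t)) \<le> 5 / c * integral {a..b} g"
      by (rule measure_UN_bound[OF C(1) _ bound]) auto
  qed (rule C)
qed

text \<open>
  The intervals of radius at most \<open>pi\<close> around points of \<open>{0<..<2 * pi}\<close> lie within three turns.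
\<close>
lemma integral_circle_three_turns:
  assumes "f holomorphic_on ball 0 R" "1 < R"
  shows "integral {-2 * pi..4 * pi} (\<lambda>s. Re (f (cis s))) = 6 * pi * Re (f 0)"
proof -
  let ?g = "\<lambda>s. Re (f (cis s))"
  have "continuous_on A ?g" for A
    using assms(2) by (intro continuous_intros continuous_on_compose2[OF holomorphic_on_imp_continuous_on[OF assms(1)]]) auto
  then have int: "?g integrable_on {u..v}" for u v
    by (rule integrable_continuous_real)
  have 0: "integral {0..2 * pi} ?g = 2 * pi * Re (f 0)"
    using has_integral_Re[OF Poisson_formula[OF assms, of 0]]
    unfolding Re_of_real_mult by (simp add: integral_unique poisson_kernel_def)
  have "integral {0..2 * pi} (?g \<circ> (+) (2 * pi)) = integral {0 + 2 * pi..2 * pi + 2 * pi} ?g"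
    by (rule integral_shift_Icc_real)
  then have 1: "integral {2 * pi..4 * pi} ?g = 2 * pi * Re (f 0)"
    by (simp add: o_def cis_mult[symmetric] 0)
  have "integral {-2 * pi..0} (?g \<circ> (+) (2 * pi)) = integral {-2 * pi + 2 * pi..0 + 2 * pi} ?g"
    by (rule integral_shift_Icc_real)
  then have 2: "integral {-2 * pi..0} ?g = 2 * pi * Re (f 0)"
    by (simp add: o_def cis_mult[symmetric] 0)
  have "integral {-2 * pi..0} ?g + integral {0..4 * pi} ?g = integral {-2 * pi..4 * pi} ?g"
    by (intro Henstock_Kurzweil_Integration.integral_combine int) auto
  moreover have "integral {0..2 * pi} ?g + integral {2 * pi..4 * pi} ?g = integral {0..4 * pi} ?g"
    by (intro Henstock_Kurzweil_Integration.integral_combine int) auto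
  ultimately show ?thesis using 0 1 2 by simp
qed

text \<open>
  A radius on which \<open>Re F\<close> exceeds \<open>c\<close> ends, by \<open>harmonic_le_of_averages\<close>, at the centre of an
  interval over which the boundary values have average above \<open>c\<close>. As \<open>F\<close> need not extend to the
  circle, this is done on the disks of radius \<open>\<rho> < 1\<close> with a bound that does not depend on \<open>\<rho>\<close>.
\<close>
lemma radial_maximal_inequality:
  assumes F: "F holomorphic_on unit_disk" "\<And>z. norm z < 1 \<Longrightarrow> 0 \<le> Re (F z)" and c: "0 < c"
  obtains U where "U \<in> lmeasurable" "measure lebesgue U \<le> 30 * pi / c * Re (F 0)"
    "{t \<in> {0<..<2 * pi}. \<exists>r\<in>{0..<1}. c < Re (F (of_real r * cis t))} \<subseteq> U"
proof -
  define E where "E \<rho> = {t \<in> {0<..<2 * pi}. \<exists>r\<in>{0..<\<rho>}. c < Re (F (of_real r * cis t))}" for \<rho> :: real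
  define M where "M = 30 * pi / c * Re (F 0)"
  have E_meas: "E \<rho> \<in> lmeasurable" if "\<rho> \<le> 1" for \<rho>
  proof -
    have "open {t \<in> {0<..<2 * pi}. c < Re (F (of_real r * cis t))}" if "r \<in> {0..<\<rho>}" for r
    proof -
      have "continuous_on {0<..<2 * pi} (\<lambda>t. Re (F (of_real r * cis t)))"
        using that \<open>\<rho> \<le> 1\<close>
        by (intro continuous_intros continuous_on_compose2[OF holomorphic_on_imp_continuous_on[OF F(1)]]) auto
      then have "open ({0<..<2 * pi} \<inter> (\<lambda>t. Re (F (of_real r * cis t))) -` {c<..})"
        by (rule continuous_open_preimage) auto
      also have "{0<..<2 * pi} \<inter> (\<lambda>t. Re (F (of_real r * cis t))) -` {c<..} = {t \<in> {0<..<2 * pi}. c < Re (F (of_real r * cis t))}"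
        by auto
      finally show ?thesis .
    qed
    then have "open (\<Union>r\<in>{0..<\<rho>}. {t \<in> {0<..<2 * pi}. c < Re (F (of_real r * cis t))})" by blast
    also have "(\<Union>r\<in>{0..<\<rho>}. {t \<in> {0<..<2 * pi}. c < Re (F (of_real r * cis t))}) = E \<rho>"
      by (auto simp: E_def)
    finally have "open (E \<rho>)" .
    moreover have "bounded (E \<rho>)"
      by (rule bounded_subset[OF bounded_closed_interval[of 0 "2 * pi"]]) (auto simp: E_def)
    ultimately show ?thesis by (intro lmeasurable_open)
  qed
  have E_le: "measure lebesgue (E \<rho>) \<le> M" if \<rho>: "0 < \<rho>" "\<rho> < 1" for \<rho>
  proof -
    define f where "f z = F (of_real \<rho> * z)" for z
    have R: "1 < 1 / \<rho>" using \<rho> by simp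
    have f: "f holomorphic_on ball 0 (1 / \<rho>)"
      unfolding f_def using \<rho>
      by (intro holomorphic_on_compose_gen[OF _ F(1), unfolded o_def])
         (auto intro!: holomorphic_intros simp: norm_mult field_simps)
    define g where "g s = Re (f (cis s))" for s
    have cg: "continuous_on UNIV g" unfolding g_def
      using R by (intro continuous_intros continuous_on_compose2[OF holomorphic_on_imp_continuous_on[OF f]]) auto
    have g0: "0 \<le> g s" for s using F(2) \<rho> by (auto simp: g_def f_def norm_mult)
    have "\<exists>\<delta>. 0 < \<delta> \<and> \<delta> \<le> pi \<and> -2 * pi \<le> t - \<delta> \<and> t + \<delta> \<le> 4 * pi \<and> 2 * c * \<delta> < integral {t - \<delta>..t + \<delta>} g"
      if t: "t \<in> E \<rho>" for t
    proof (rule ccontr)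
      assume neg: "\<not> ?thesis"
      obtain r where r: "0 \<le> r" "r < \<rho>" "c < Re (F (of_real r * cis t))" using t by (auto simp: E_def)
      have avg: "integral {t - \<delta>..t + \<delta>} g \<le> 2 * c * \<delta>" if "0 < \<delta>" "\<delta> \<le> pi" for \<delta>
        using neg that t by (force simp: E_def not_less)
      have "Re (f (of_real (r / \<rho>) * cis t)) \<le> c"
        by (rule harmonic_le_of_averages[OF f R]) (use r \<rho> avg in \<open>auto simp: g_def[abs_def]\<close>)
      moreover have "f (of_real (r / \<rho>) * cis t) = F (of_real r * cis t)" using \<rho> by (simp add: f_def)
      ultimately show False using r by simp
    qed
    then obtain U where U: "U \<in> lmeasurable" "E \<rho> \<subseteq> U" "measure lebesgue U \<le> 5 / c * integral {-2 * pi..4 * pi} g"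
      by (rule weak_type_covering[OF cg g0 c])
    have "integral {-2 * pi..4 * pi} g = 6 * pi * Re (F 0)"
      using integral_circle_three_turns[OF f R] by (simp add: g_def[abs_def] f_def)
    then have "measure lebesgue U \<le> M" using U(3) c by (simp add: M_def)
    then show ?thesis
      using measure_mono_fmeasurable[OF U(2) fmeasurableD[OF E_meas] U(1)] \<rho> by linarith
  qed
  define \<rho> where "\<rho> n = 1 - 1 / (real n + 2)" for n
  have \<rho>: "0 < \<rho> n" "\<rho> n < 1" "\<rho> n \<le> \<rho> (Suc n)" for n by (auto simp: \<rho>_def field_simps)
  have nest: "E (\<rho> n) \<subseteq> E (\<rho> (Suc n))" for n using \<rho>(3)[of n] by (auto simp: E_def intro: less_le_trans)
  have meas: "E (\<rho> n) \<in> lmeasurable" "measure lebesgue (E (\<rho> n)) \<le> M" for n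
    using E_meas[of "\<rho> n"] E_le[OF \<rho>(1,2)] \<rho>(2)[of n] by auto
  show ?thesis
  proof (rule that)
    show "(\<Union>n. E (\<rho> n)) \<in> lmeasurable"
      using measurable_nested_Union[of "\<lambda>n. E (\<rho> n)", OF meas nest] .
    show "measure lebesgue (\<Union>n. E (\<rho> n)) \<le> 30 * pi / c * Re (F 0)"
      using LIMSEQ_le_const2[OF measure_nested_Union[of "\<lambda>n. E (\<rho> n)", OF meas nest]] meas(2) unfolding M_def[symmetric] by blast
    show "{t \<in> {0<..<2 * pi}. \<exists>r\<in>{0..<1}. c < Re (F (of_real r * cis t))} \<subseteq> (\<Union>n. E (\<rho> n))"
    proof safe
      fix t r assume t: "t \<in> {0<..<2 * pi}" "r \<in> {0..<1}" "c < Re (F (of_real r * cis t))"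
      have "\<rho> \<longlonglongrightarrow> 1" unfolding \<rho>_def by real_asymp
      then have "\<forall>\<^sub>F n in sequentially. r < \<rho> n" by (rule order_tendstoD) (use t in auto)
      then obtain n where "r < \<rho> n" by (auto simp: eventually_sequentially)
      then show "t \<in> (\<Union>n. E (\<rho> n))" using t by (auto simp: E_def intro!: exI[of _ n] bexI[of _ r])
    qed
  qed
qed

section \<open>Blaschke products are inner\<close>

lemma tendsto_at_left_of_cauchy:
  fixes f :: "real \<Rightarrow> complex"
  assumes "\<And>e. 0 < e \<Longrightarrow> \<exists>s<1. \<forall>r\<in>{s<..<1}. \<forall>r'\<in>{s<..<1}. norm (f r - f r') < e"
  obtains l where "(f \<longlongrightarrow> l) (at_left 1)"
proof -
  define x where "x n = f (1 - 1 / (real n + 2))" for n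
  have lim: "(\<lambda>n. 1 - 1 / (real n + 2)) \<longlonglongrightarrow> 1" by real_asymp
  have ev: "\<forall>\<^sub>F n in sequentially. 1 - 1 / (real n + 2) \<in> {s<..<1}" if "s < 1" for s
  proof -
    have "\<forall>\<^sub>F n in sequentially. s < 1 - 1 / (real n + 2)" by (rule order_tendstoD(1)[OF lim that])
    then show ?thesis by eventually_elim auto
  qed
  have "Cauchy x"
  proof (rule CauchyI)
    fix e :: real assume "0 < e"
    then obtain s where s: "s < 1" "\<forall>r\<in>{s<..<1}. \<forall>r'\<in>{s<..<1}. norm (f r - f r') < e" using assms by blast
    obtain N where "\<forall>n\<ge>N. 1 - 1 / (real n + 2) \<in> {s<..<1}"
      using ev[OF s(1)] unfolding eventually_sequentially by blast
    then show "\<exists>M. \<forall>m\<ge>M. \<forall>n\<ge>M. norm (x m - x n) < e" using s(2) unfolding x_def by blast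
  qed
  then obtain l where l: "x \<longlonglongrightarrow> l" by (auto simp: Cauchy_convergent_iff convergent_def)
  have "(f \<longlongrightarrow> l) (at_left 1)"
  proof (rule tendstoI)
    fix e :: real assume "0 < e"
    then obtain s where s: "s < 1" "\<forall>r\<in>{s<..<1}. \<forall>r'\<in>{s<..<1}. norm (f r - f r') < e / 2"
      using assms[of "e / 2"] by auto
    have "dist (f r) l < e" if r: "r \<in> {s<..<1}" for r
    proof -
      have "(\<lambda>n. norm (f r - x n)) \<longlonglongrightarrow> norm (f r - l)" by (intro tendsto_intros l)
      moreover have "\<forall>\<^sub>F n in sequentially. norm (f r - x n) \<le> e / 2"
        using ev[OF s(1)] by eventually_elim (use s(2) r in \<open>auto simp: x_def intro: less_imp_le\<close>)
      ultimately have "norm (f r - l) \<le> e / 2" by (intro tendsto_upperbound) auto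
      then show ?thesis using \<open>0 < e\<close> by (simp add: dist_norm)
    qed
    then show "\<forall>\<^sub>F r in at_left 1. dist (f r) l < e"
      using eventually_at_left_real[OF s(1)] by (rule eventually_mono[rotated])
  qed
  then show ?thesis by (rule that)
qed

text \<open>
  A radius outside the exceptional set \<open>N\<close> has the property that for every \<open>c > 0\<close> some tail satisfies
  \<open>Re (1 - T n) \<le> c\<close> along the whole radius; then \<open>B\<close> is close to the continuous function \<open>P n\<close>
  there. The set \<open>N\<close> is negligible since the value of \<open>Re (1 - T n)\<close> at 0 tends to 0.
\<close>
lemma blaschke_product_inner:
  assumes B: "blaschke_product B"
  shows "inner_function B"
proof -
  obtain P T :: "nat \<Rightarrow> complex \<Rightarrow> complex" where
    P: "\<And>n. continuous_on (cball 0 1) (P n)" "\<And>n z. norm z = 1 \<Longrightarrow> norm (P n z) = 1"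
       "\<And>n z. norm z \<le> 1 \<Longrightarrow> norm (P n z) \<le> 1" and
    T: "\<And>n. T n holomorphic_on unit_disk" "\<And>n z. norm z < 1 \<Longrightarrow> norm (T n z) \<le> 1"
       "\<And>z. norm z < 1 \<Longrightarrow> (\<lambda>n. T n z) \<longlonglongrightarrow> 1" and
    BPT: "\<And>n z. norm z < 1 \<Longrightarrow> B z = P n z * T n z"
    using blaschke_product_approx[OF B] by metis
  define E where "E n c = {t \<in> {0<..<2 * pi}. \<exists>r\<in>{0..<1}. c < Re (1 - T n (of_real r * cis t))}" for n and c :: real
  have E_negl: "negligible (\<Inter>n. E n c)" if c: "0 < c" for c
    unfolding negligible_outer_le
  proof (intro allI impI)
    fix e :: real assume e: "0 < e"
    have "(\<lambda>n. 30 * pi / c * Re (1 - T n 0)) \<longlonglongrightarrow> 30 * pi / c * Re (1 - 1)"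
      by (intro tendsto_intros T(3)) simp
    then have "\<forall>\<^sub>F n in sequentially. 30 * pi / c * Re (1 - T n 0) < e"
      by (rule order_tendstoD) (use e in simp)
    then obtain n where n: "30 * pi / c * Re (1 - T n 0) < e" by (auto simp: eventually_sequentially)
    have hol: "(\<lambda>z. 1 - T n z) holomorphic_on unit_disk" by (intro holomorphic_intros T)
    have nonneg: "0 \<le> Re (1 - T n z)" if "norm z < 1" for z
      using T(2)[OF that, of n] complex_Re_le_cmod[of "T n z"] by simp
    obtain U where "U \<in> lmeasurable" "measure lebesgue U \<le> 30 * pi / c * Re (1 - T n 0)" "E n c \<subseteq> U"
      unfolding E_def using radial_maximal_inequality[OF hol nonneg c] by blast
    then show "\<exists>U. (\<Inter>n. E n c) \<subseteq> U \<and> U \<in> lmeasurable \<and> measure lebesgue U \<le> e"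
      using n by (intro exI[of _ U]) auto
  qed
  define N where "N = (\<Union>k. \<Inter>n. E n (1 / real (Suc k))) \<union> {0, 2 * pi}"
  have "negligible N" unfolding N_def
    by (intro negligible_Un negligible_countable_Union) (auto intro!: E_negl)
  have limit: "\<exists>l. ((\<lambda>r. B (of_real r * cis t)) \<longlongrightarrow> l) (at_left 1) \<and> cmod l = 1"
    if t: "t \<in> {0..2 * pi}" "t \<notin> N" for t
  proof -
    let ?b = "\<lambda>r. B (of_real r * cis t)"
    \<comment> \<open>Near the end of the radius, \<open>B\<close> is within \<open>e\<close> of a number of modulus 1.\<close>
    have key: "\<exists>n. \<exists>s<1. (\<forall>r\<in>{s<..<1}. norm (?b r - P n (cis t)) < e)" if e: "0 < e" for e
    proof -
      obtain k where k: "1 / real (Suc k) < e\<^sup>2 / 8"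
        using nat_approx_posE[of "e\<^sup>2 / 8"] e by auto
      obtain n where n: "t \<notin> E n (1 / real (Suc k))" using t by (auto simp: N_def)
      have Tn: "norm (1 - T n (of_real r * cis t)) \<le> e / 2" if r: "r \<in> {0..<1}" for r
      proof -
        let ?w = "T n (of_real r * cis t)"
        have "Re (1 - ?w) \<le> 1 / real (Suc k)" using n t r by (force simp: E_def N_def not_less)
        moreover have "(norm (1 - ?w))\<^sup>2 \<le> 2 * Re (1 - ?w)"
        proof -
          have "(norm ?w)\<^sup>2 \<le> 1" using T(2)[of "of_real r * cis t" n] r by (simp add: power_le_one)
          then show ?thesis unfolding cmod_power2 by (simp add: power2_eq_square algebra_simps)
        qed
        ultimately have "(norm (1 - ?w))\<^sup>2 \<le> (e / 2)\<^sup>2" using k by (simp add: power_divide)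
        then show ?thesis by (rule power2_le_imp_le) (use e in simp)
      qed
      have "continuous_on {0..1} (\<lambda>r. P n (of_real r * cis t))"
        by (intro continuous_on_compose2[OF P(1)] continuous_intros) (auto simp: norm_mult)
      then have "((\<lambda>r. P n (of_real r * cis t)) \<longlongrightarrow> P n (cis t)) (at 1 within {0..1})"
        unfolding continuous_on_def by (metis atLeastAtMost_iff mult_1 of_real_1 order_refl zero_le_one)
      then have "((\<lambda>r. P n (of_real r * cis t)) \<longlongrightarrow> P n (cis t)) (at_left 1)"
        by (simp add: at_within_Icc_at_left)
      then have "\<forall>\<^sub>F r in at_left 1. norm (P n (of_real r * cis t) - P n (cis t)) < e / 2"
        unfolding dist_norm[symmetric] by (rule tendstoD) (use e in simp)
      then obtain s where s: "s < 1" "\<And>r. s < r \<Longrightarrow> r < 1 \<Longrightarrow> norm (P n (of_real r * cis t) - P n (cis t)) < e / 2"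
        unfolding eventually_at_left_field by blast
      have "norm (?b r - P n (cis t)) < e" if r: "r \<in> {max s 0<..<1}" for r
      proof -
        let ?z = "of_real r * cis t"
        have z: "norm ?z < 1" using r by simp
        have "?b r - P n (cis t) = (P n ?z - P n (cis t)) - P n ?z * (1 - T n ?z)"
          using BPT[OF z, of n] by (simp add: algebra_simps)
        then have "norm (?b r - P n (cis t)) \<le> norm (P n ?z - P n (cis t)) + norm (P n ?z) * norm (1 - T n ?z)"
          using norm_triangle_ineq4 by (metis norm_mult)
        also have "norm (P n ?z) * norm (1 - T n ?z) \<le> 1 * (e / 2)"
          using P(3)[of ?z n] z Tn[of r] r by (intro mult_mono) auto
        also have "norm (P n ?z - P n (cis t)) < e / 2" using s(2)[of r] r by auto
        finally show ?thesis by simp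
      qed
      then show ?thesis using s(1) by (intro exI[of _ n] exI[of _ "max s 0"]) auto
    qed
    have "\<exists>s<1. \<forall>r\<in>{s<..<1}. \<forall>r'\<in>{s<..<1}. norm (?b r - ?b r') < e" if "0 < e" for e
    proof -
      have "0 < e / 2" using \<open>0 < e\<close> by simp
      from key[OF this] obtain n s where s: "s < 1" "\<forall>r\<in>{s<..<1}. norm (?b r - P n (cis t)) < e / 2"
        by blast
      have "norm (?b r - ?b r') < e" if "r \<in> {s<..<1}" "r' \<in> {s<..<1}" for r r'
        using norm_triangle_lt[of "?b r - P n (cis t)" "- (?b r' - P n (cis t))" e] bspec[OF s(2) that(1)] bspec[OF s(2) that(2)]
        by (simp add: norm_minus_commute)
      then show ?thesis using s(1) by blast
    qed
    then obtain l where l: "(?b \<longlongrightarrow> l) (at_left 1)" by (rule tendsto_at_left_of_cauchy)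
    have near: "\<bar>norm l - 1\<bar> \<le> 0 + e" if "0 < e" for e
    proof -
      from key[OF that] obtain n s where s: "s < 1" "\<forall>r\<in>{s<..<1}. norm (?b r - P n (cis t)) < e"
        by blast
      have "((\<lambda>r. norm (?b r - P n (cis t))) \<longlongrightarrow> norm (l - P n (cis t))) (at_left 1)"
        by (intro tendsto_intros l)
      moreover have "\<forall>\<^sub>F r in at_left 1. norm (?b r - P n (cis t)) \<le> e"
        using eventually_at_left_real[OF s(1)] by eventually_elim (use s(2) in \<open>auto intro: less_imp_le\<close>)
      ultimately have "norm (l - P n (cis t)) \<le> e" by (intro tendsto_upperbound) auto
      then show ?thesis using norm_triangle_ineq3[of l "P n (cis t)"] P(2)[of "cis t" n] by simp
    qed
    have "\<bar>norm l - 1\<bar> \<le> 0" by (rule field_le_epsilon[OF near])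
    then have "norm l = 1" by simp
    with l show ?thesis by blast
  qed
  have "AE t in lebesgue. t \<in> {0..2 * pi} \<longrightarrow> (\<exists>l. ((\<lambda>r. B (of_real r * cis t)) \<longlongrightarrow> l) (at_left 1) \<and> cmod l = 1)"
    by (rule AE_I'[of N]) (use \<open>negligible N\<close> limit in \<open>auto simp: negligible_iff_null_sets\<close>)
  then have "AE t in lebesgue_on {0..2 * pi}. \<exists>l. ((\<lambda>r. B (of_real r * cis t)) \<longlongrightarrow> l) (at_left 1) \<and> cmod l = 1"
    by (subst AE_restrict_space_iff) auto
  moreover have "bounded (B ` unit_disk)"
    using norm_blaschke_product_le_1[OF B] by (auto intro!: boundedI[of _ 1])
  ultimately show ?thesis
    unfolding inner_function_def using blaschke_product_holomorphic[OF B] by (intro conjI)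
qed

section \<open>Factorization of inner functions\<close>

lemma countable_enumeration:
  assumes "countable X"
  obtains N :: enat and e :: "nat \<Rightarrow> 'a" where "bij_betw e {i. enat i < N} X"
proof (cases "finite X")
  case True
  then obtain e where "bij_betw e {0..<card X} X" using ex_bij_betw_nat_finite by blast
  moreover have "{0..<card X} = {i. enat i < enat (card X)}" by auto
  ultimately show ?thesis using that by metis
next
  case False
  then have "bij_betw (from_nat_into X) UNIV X" using assms by (intro bij_betw_from_nat_into)
  then show ?thesis using that[of "from_nat_into X" \<infinity>] by simp
qed

lemma zorder_pos_at_zero:
  assumes "f holomorphic_on unit_disk" "\<exists>z\<in>unit_disk. f z \<noteq> 0" "w \<in> unit_disk" "f w = 0"
  shows "0 < zorder f w"
  using zorder_exist_zero[OF assms(1) open_ball connected_ball assms(3,2)] assms(4) by simp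

lemma zorder_nonneg_disk:
  assumes "f holomorphic_on unit_disk" "\<exists>z\<in>unit_disk. f z \<noteq> 0" "w \<in> unit_disk"
  shows "0 \<le> zorder f w"
  using zorder_pos_at_zero[OF assms] zorder_nonzero_disk[OF assms(1,3)] by (cases "f w = 0") auto

lemma fsigma_unit_disk: "fsigma unit_disk"
proof -
  have "unit_disk = (\<Union>n. cball 0 (1 - inverse (real (Suc n))))"
  proof (intro equalityI subsetI)
    fix z :: complex assume "z \<in> unit_disk"
    then obtain n where "inverse (real (Suc n)) < 1 - norm z" using reals_Archimedean[of "1 - norm z"] by auto
    then show "z \<in> (\<Union>n. cball 0 (1 - inverse (real (Suc n))))" by (intro UN_I[of n]) auto
  next
    fix z :: complex assume "z \<in> (\<Union>n. cball 0 (1 - inverse (real (Suc n))))"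
    then obtain n where "norm z \<le> 1 - inverse (real (Suc n))" by auto
    moreover have "0 < inverse (real (Suc n))" by simp
    ultimately show "z \<in> unit_disk" unfolding mem_ball_0 by linarith
  qed
  then show ?thesis using fsigma.intros[of "\<lambda>n. cball (0::complex) (1 - inverse (real (Suc n)))"] by simp
qed

text \<open>
  The zeros of \<open>h\<close>, repeated according to multiplicity, form a Blaschke sequence: dividing \<open>h\<close> by a
  partial product keeps the bound \<open>C\<close>, and at 0 this says that \<open>|h 0|\<close> is at most \<open>C\<close> times the product of
  the moduli of the first zeros.
\<close>
lemma bounded_zeros_factorization:
  assumes h: "h holomorphic_on unit_disk" "h 0 \<noteq> 0" "\<And>z. norm z < 1 \<Longrightarrow> norm (h z) \<le> C"
  obtains N a S where "blaschke_sequence N a" "S holomorphic_on unit_disk"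
    "\<And>z. z \<in> unit_disk \<Longrightarrow> S z \<noteq> 0" "\<And>z. z \<in> unit_disk \<Longrightarrow> h z = blaschke_sequence.tail N a 0 z * S z"
proof -
  have h_nz: "\<exists>z\<in>unit_disk. h z \<noteq> 0" using h(2) by (intro bexI[of _ 0]) auto
  define Z where "Z = {z \<in> unit_disk. h z = 0}"
  have "countable Z"
  proof (cases "h constant_on unit_disk")
    case True
    then have "Z = {}" using h_nz by (auto simp: Z_def constant_on_def)
    then show ?thesis by simp
  next
    case False
    then show ?thesis unfolding Z_def by (intro holomorphic_countable_zeros[OF h(1)] fsigma_unit_disk) auto
  qed
  \<comment> \<open>One copy of each zero for each unit of its multiplicity.\<close>
  define X where "X = Sigma Z (\<lambda>w. {..<nat (zorder h w)})"
  have "countable X" unfolding X_def using \<open>countable Z\<close> by (intro countable_SIGMA) auto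
  then obtain N :: enat and e where e: "bij_betw e {i. enat i < N} X" by (rule countable_enumeration)
  define a where "a i = fst (e i)" for i
  have a_in: "a i \<in> Z" if "enat i < N" for i
    using bij_betw_apply[OF e, of i] that by (auto simp: X_def a_def)
  interpret disk_sequence N a
    by unfold_locales (use a_in h(2) in \<open>force simp: Z_def\<close>)
  have count: "finite {i. enat i < N \<and> a i = w} \<and> zorder h w = int (card {i. enat i < N \<and> a i = w})"
    if w: "w \<in> unit_disk" for w
  proof -
    define W where "W = (if h w = 0 then {w} \<times> {..<nat (zorder h w)} else {})"
    have bij: "bij_betw e {i. enat i < N \<and> a i = w} W"
    proof (rule bij_betw_imageI)
      show "inj_on e {i. enat i < N \<and> a i = w}"
        using bij_betw_imp_inj_on[OF e] by (rule inj_on_subset) blast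
      have "W = {x \<in> X. fst x = w}"
        using w by (auto simp: W_def X_def Z_def)
      also have "\<dots> = e ` {i. enat i < N \<and> a i = w}"
        unfolding bij_betw_imp_surj_on[OF e, symmetric] a_def by blast
      finally show "e ` {i. enat i < N \<and> a i = w} = W" by (rule sym)
    qed
    have "finite W" by (simp add: W_def)
    then have fin: "finite {i. enat i < N \<and> a i = w}"
      unfolding bij_betw_finite[OF bij] .
    have card: "card {i. enat i < N \<and> a i = w} = (if h w = 0 then nat (zorder h w) else 0)"
      unfolding bij_betw_same_card[OF bij] by (simp add: W_def card_cartesian_product)
    show ?thesis
    proof (cases "h w = 0")
      case True
      then show ?thesis using fin card zorder_nonneg_disk[OF h(1) h_nz w] by simp
    next
      case False
      then show ?thesis using fin card zorder_nonzero_disk[OF h(1) w False] by simp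
    qed
  qed
  have partial_bound: "(\<Sum>i<n. defect i) \<le> ln (C / norm (h 0))" for n
  proof -
    obtain q where q: "q holomorphic_on unit_disk" "\<And>z. z \<in> unit_disk \<Longrightarrow> h z = partial n z * q z"
    proof (rule holomorphic_divide_zorder[OF open_ball connected_ball h(1) h_nz partial_holomorphic])
      show "\<exists>z\<in>unit_disk. partial n z \<noteq> 0" using partial_0_nonzero by (intro bexI[of _ 0]) auto
      show "zorder (partial n) w \<le> zorder h w" if w: "w \<in> unit_disk" for w
      proof -
        have "card {i. i < n \<and> enat i < N \<and> a i = w} \<le> card {i. enat i < N \<and> a i = w}"
          using count[OF w] by (intro card_mono) auto
        then show ?thesis using count[OF w] zorder_partial[OF w, of n] by simp
      qed
    qed blast
    have "norm (q 0) \<le> C"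
      using q h(3) by (intro norm_divide_unimodular_le[OF continuous_on_partial[of n] norm_partial_eq_1[of _ n] q(1)]) auto
    have "norm (h 0) = (\<Prod>i<n. 1 - defect i) * norm (q 0)"
      using q(2)[of 0] by (simp add: norm_mult partial_def prod_norm[symmetric] norm_factor_0)
    also have "\<dots> \<le> exp (- (\<Sum>i<n. defect i)) * C"
    proof (rule mult_mono)
      have "0 \<le> 1 - defect i" for i using norm_factor_0[of i] norm_ge_zero[of "factor i 0"] by simp
      then have "(\<Prod>i<n. 1 - defect i) \<le> (\<Prod>i<n. exp (- defect i))"
        using exp_ge_add_one_self[of "- defect _"] by (intro prod_mono) auto
      then show "(\<Prod>i<n. 1 - defect i) \<le> exp (- (\<Sum>i<n. defect i))"
        by (simp add: exp_sum sum_negf[symmetric])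
    qed (use \<open>norm (q 0) \<le> C\<close> in auto)
    finally have "exp (\<Sum>i<n. defect i) \<le> C / norm (h 0)"
      using h(2) by (simp add: exp_minus field_simps)
    moreover from this have "0 < C / norm (h 0)" by (rule less_le_trans[OF exp_gt_zero])
    ultimately show ?thesis by (subst ln_ge_iff)
  qed
  have "summable defect"
    by (rule summableI_nonneg_bounded[OF defect_nonneg partial_bound])
  then interpret blaschke_sequence N a by unfold_locales
  obtain S where S: "S holomorphic_on unit_disk" "\<And>z. z \<in> unit_disk \<Longrightarrow> h z = tail 0 z * S z"
    "\<And>w. w \<in> unit_disk \<Longrightarrow> zorder h w = zorder (tail 0) w \<Longrightarrow> S w \<noteq> 0"
  proof (rule holomorphic_divide_zorder[OF open_ball connected_ball h(1) h_nz tail_holomorphic])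
    show "\<exists>z\<in>unit_disk. tail 0 z \<noteq> 0" using tail_0_nonzero by (intro bexI[of _ 0]) auto
    show "zorder (tail 0) w \<le> zorder h w" if w: "w \<in> unit_disk" for w
      using count[OF w] zorder_tail_0[OF w] by simp
  qed blast
  have "S z \<noteq> 0" if "z \<in> unit_disk" for z
    using S(3)[OF that] count[OF that] zorder_tail_0[OF that] by simp
  then show ?thesis by (rule that[OF blaschke_sequence_axioms S(1) _ S(2)])
qed

lemma inner_function_nonzero:
  assumes "inner_function \<theta>"
  shows "\<exists>z\<in>unit_disk. \<theta> z \<noteq> 0"
proof (rule ccontr)
  assume neg: "\<not> ?thesis"
  have "AE t in lebesgue_on {0..2 * pi}. \<exists>l. ((\<lambda>r. \<theta> (of_real r * cis t)) \<longlongrightarrow> l) (at_left 1) \<and> cmod l = 1"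
    using assms by (simp add: inner_function_def)
  then have "AE t in lebesgue_on {0..2 * pi}. False"
  proof eventually_elim
    fix t assume "\<exists>l. ((\<lambda>r. \<theta> (of_real r * cis t)) \<longlongrightarrow> l) (at_left 1) \<and> cmod l = 1"
    then obtain l where l: "((\<lambda>r. \<theta> (of_real r * cis t)) \<longlongrightarrow> l) (at_left 1)" "cmod l = 1" by blast
    have "\<forall>\<^sub>F r in at_left (1::real). r \<in> {0<..<1}" by (rule eventually_at_left_real) simp
    then have "\<forall>\<^sub>F r in at_left (1::real). \<theta> (of_real r * cis t) = 0"
      by eventually_elim (use neg in auto)
    then have "((\<lambda>r. \<theta> (of_real r * cis t)) \<longlongrightarrow> 0) (at_left 1)" by (rule tendsto_eventually)
    then have "l = 0" using l(1) by (intro tendsto_unique[of "at_left (1::real)"]) auto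
    then show False using l(2) by simp
  qed
  then have "emeasure (lebesgue_on {0..2 * pi}) (space (lebesgue_on {0..2 * pi})) = 0"
    unfolding ae_filter_eq_bot_iff[symmetric] trivial_limit_def .
  then show False by (simp add: emeasure_restrict_space)
qed

text \<open>
  Reduces statements about products and quotients of inner functions to a statement about limits
  along a single radius.
\<close>
lemma inner_function_of_radial_limits:
  assumes "inner_function f" "inner_function g" "h holomorphic_on unit_disk" "bounded (h ` unit_disk)"
    and lim: "\<And>t a b. ((\<lambda>r. f (of_real r * cis t)) \<longlongrightarrow> a) (at_left 1) \<Longrightarrow> norm a = 1 \<Longrightarrow>
      ((\<lambda>r. g (of_real r * cis t)) \<longlongrightarrow> b) (at_left 1) \<Longrightarrow> norm b = 1 \<Longrightarrow>
      \<exists>l. ((\<lambda>r. h (of_real r * cis t)) \<longlongrightarrow> l) (at_left 1) \<and> norm l = 1"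
  shows "inner_function h"
proof -
  have "AE t in lebesgue_on {0..2 * pi}. \<exists>l. ((\<lambda>r. f (of_real r * cis t)) \<longlongrightarrow> l) (at_left 1) \<and> cmod l = 1"
    "AE t in lebesgue_on {0..2 * pi}. \<exists>l. ((\<lambda>r. g (of_real r * cis t)) \<longlongrightarrow> l) (at_left 1) \<and> cmod l = 1"
    using assms(1,2) by (auto simp: inner_function_def)
  then have "AE t in lebesgue_on {0..2 * pi}. \<exists>l. ((\<lambda>r. h (of_real r * cis t)) \<longlongrightarrow> l) (at_left 1) \<and> cmod l = 1"
    by eventually_elim (use lim in blast)
  then show ?thesis using assms(3,4) by (simp add: inner_function_def)
qed

lemma eventually_radius_in_disk:
  assumes "\<And>z. z \<in> unit_disk \<Longrightarrow> P z"
  shows "\<forall>\<^sub>F r in at_left (1::real). P (of_real r * cis t)"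
proof -
  have "\<forall>\<^sub>F r in at_left (1::real). r \<in> {0<..<1}" by (rule eventually_at_left_real) simp
  then show ?thesis by eventually_elim (use assms in auto)
qed

lemma inner_function_mult:
  assumes "inner_function f" "inner_function g" "\<And>z. z \<in> unit_disk \<Longrightarrow> h z = f z * g z"
  shows "inner_function h"
proof (rule inner_function_of_radial_limits[OF assms(1,2)])
  have "(\<lambda>z. f z * g z) holomorphic_on unit_disk"
    using assms(1,2) by (intro holomorphic_intros) (auto simp: inner_function_def)
  then show "h holomorphic_on unit_disk" by (rule holomorphic_transform) (use assms(3) in auto)
  obtain C D where C: "\<And>z. z \<in> unit_disk \<Longrightarrow> norm (f z) \<le> C" and D: "\<And>z. z \<in> unit_disk \<Longrightarrow> norm (g z) \<le> D"
    using assms(1,2) unfolding inner_function_def bounded_iff by blast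
  have "norm (h z) \<le> C * D" if "z \<in> unit_disk" for z
    unfolding assms(3)[OF that] norm_mult using C[OF that] D[OF that] order_trans[OF norm_ge_zero C[OF that]]
    by (intro mult_mono) auto
  then show "bounded (h ` unit_disk)" unfolding bounded_iff by blast
  fix t a b
  assume a: "((\<lambda>r. f (of_real r * cis t)) \<longlongrightarrow> a) (at_left 1)" "norm a = 1"
    and b: "((\<lambda>r. g (of_real r * cis t)) \<longlongrightarrow> b) (at_left 1)" "norm b = 1"
  have "((\<lambda>r. f (of_real r * cis t) * g (of_real r * cis t)) \<longlongrightarrow> a * b) (at_left 1)"
    by (intro tendsto_intros a b)
  then have "((\<lambda>r. h (of_real r * cis t)) \<longlongrightarrow> a * b) (at_left 1)"
    by (rule Lim_transform_eventually)
       (use eventually_radius_in_disk[of "\<lambda>z. f z * g z = h z" t] assms(3) in simp)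
  then show "\<exists>l. ((\<lambda>r. h (of_real r * cis t)) \<longlongrightarrow> l) (at_left 1) \<and> norm l = 1"
    using a(2) b(2) by (intro exI[of _ "a * b"]) (simp add: norm_mult)
qed

lemma inner_function_divide:
  assumes "inner_function f" "inner_function g" "h holomorphic_on unit_disk" "bounded (h ` unit_disk)"
    and eq: "\<And>z. z \<in> unit_disk \<Longrightarrow> f z = g z * h z"
  shows "inner_function h"
proof (rule inner_function_of_radial_limits[OF assms(1-4)])
  fix t a b
  assume a: "((\<lambda>r. f (of_real r * cis t)) \<longlongrightarrow> a) (at_left 1)" "norm a = 1"
    and b: "((\<lambda>r. g (of_real r * cis t)) \<longlongrightarrow> b) (at_left 1)" "norm b = 1"
  have b0: "b \<noteq> 0" using b(2) by auto
  have "((\<lambda>r. f (of_real r * cis t) / g (of_real r * cis t)) \<longlongrightarrow> a / b) (at_left 1)"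
    by (intro tendsto_intros a b b0)
  moreover have "\<forall>\<^sub>F r in at_left 1. f (of_real r * cis t) / g (of_real r * cis t) = h (of_real r * cis t)"
    using eventually_radius_in_disk[of "\<lambda>z. f z = g z * h z" t] eq tendsto_imp_eventually_ne[OF b(1) b0]
    by (auto elim: eventually_elim2)
  ultimately have "((\<lambda>r. h (of_real r * cis t)) \<longlongrightarrow> a / b) (at_left 1)"
    by (rule Lim_transform_eventually)
  then show "\<exists>l. ((\<lambda>r. h (of_real r * cis t)) \<longlongrightarrow> l) (at_left 1) \<and> norm l = 1"
    using a(2) b(2) by (intro exI[of _ "a / b"]) (simp add: norm_divide)
qed

text \<open>
  The power of \<open>z\<close> is split off first, so that the remaining factor does not vanish at 0.
\<close>
lemma inner_function_factorization:
  assumes "inner_function \<theta>"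
  obtains B S where "blaschke_product B" "singular_inner S" "\<And>z. z \<in> unit_disk \<Longrightarrow> \<theta> z = B z * S z"
proof -
  have holo: "\<theta> holomorphic_on unit_disk"
    using assms by (simp add: inner_function_def)
  obtain C where "\<forall>z\<in>unit_disk. norm (\<theta> z) \<le> C"
    using assms unfolding inner_function_def bounded_iff by blast
  then have C: "norm (\<theta> z) \<le> C" if "norm z < 1" for z using that by simp
  note nz = inner_function_nonzero[OF assms]
  have in0: "0 \<in> unit_disk" by simp
  define m where "m = nat (zorder \<theta> 0)"
  have m: "zorder \<theta> 0 = int m" using zorder_nonneg_disk[OF holo nz in0] by (simp add: m_def)
  have zm: "zorder (\<lambda>z::complex. z ^ m) 0 = int m" using zorder_power_diff[of 0 m] by simp
  obtain h where h: "h holomorphic_on unit_disk" "\<And>z. z \<in> unit_disk \<Longrightarrow> \<theta> z = z ^ m * h z"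
    "\<And>w. w \<in> unit_disk \<Longrightarrow> zorder \<theta> w = zorder (\<lambda>z. z ^ m) w \<Longrightarrow> h w \<noteq> 0"
  proof (rule holomorphic_divide_zorder[OF open_ball connected_ball holo nz])
    show "(\<lambda>z::complex. z ^ m) holomorphic_on unit_disk" by (intro holomorphic_intros)
    show "\<exists>z::complex\<in>unit_disk. z ^ m \<noteq> 0" by (intro bexI[of _ "1 / 2"]) auto
    show "zorder (\<lambda>z. z ^ m) w \<le> zorder \<theta> w" if "w ^ m = 0" for w
      using that m zm by auto
  qed blast
  have h0: "h 0 \<noteq> 0" using h(3)[of 0] m zm by simp
  have "norm (h w) \<le> C" if "norm w < 1" for w
    by (rule norm_divide_unimodular_le[of "\<lambda>z. z ^ m", OF _ _ h(1) that])
       (use C h(2) in \<open>auto intro!: continuous_intros simp: norm_power\<close>)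
  then obtain N a S where S: "blaschke_sequence N a" "S holomorphic_on unit_disk"
    "\<And>z. z \<in> unit_disk \<Longrightarrow> S z \<noteq> 0" "\<And>z. z \<in> unit_disk \<Longrightarrow> h z = blaschke_sequence.tail N a 0 z * S z"
    using bounded_zeros_factorization[OF h(1) h0] by metis
  define B where "B z = 1 * z ^ m * blaschke_sequence.tail N a 0 z" for z
  have B: "blaschke_product B"
    unfolding blaschke_product_iff B_def
    using S(1) by (intro exI[of _ 1] exI[of _ m] exI[of _ N] exI[of _ a]) simp
  have eq: "\<theta> z = B z * S z" if "z \<in> unit_disk" for z
    using h(2)[OF that] S(4)[OF that] by (simp add: B_def)
  have "norm (S z) \<le> C" if "norm z < 1" for z
    by (rule norm_divide_blaschke_le[OF B S(2) that]) (use C eq in auto)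
  then have "bounded (S ` unit_disk)" by (auto simp: bounded_iff intro!: exI[of _ C])
  then have "inner_function S"
    using inner_function_divide[OF assms blaschke_product_inner[OF B] S(2) _ eq] by blast
  then have "singular_inner S" using S(3) by (simp add: singular_inner_def)
  with B show ?thesis using eq by (rule that)
qed

section \<open>Composition and multiplicities\<close>

lemma vanishing_mult_le_of_factor:
  assumes B: "B holomorphic_on unit_disk" "\<exists>z\<in>unit_disk. B z \<noteq> 0" and k: "k holomorphic_on unit_disk"
    and f: "\<And>z. z \<in> unit_disk \<Longrightarrow> f z = B z * k z" and w: "w \<in> unit_disk"
  shows "vanishing_mult B w \<le> vanishing_mult f w"
proof (cases "B w = 0 \<and> (\<exists>z\<in>unit_disk. f z \<noteq> 0)")
  case True
  have k_nz: "\<exists>z\<in>unit_disk. k z \<noteq> 0" using True f by force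
  have "zorder f w = zorder (\<lambda>z. B z * k z) w" by (rule zorder_cong_disk[OF f w])
  also have "\<dots> = zorder B w + zorder k w" by (rule zorder_mult_disk[OF B k k_nz w])
  finally have "zorder B w \<le> zorder f w" using zorder_nonneg_disk[OF k k_nz w] by simp
  then show ?thesis using True B(2) f[OF w] by (auto simp: vanishing_mult_def)
next
  case False
  then show ?thesis using f[OF w] B(2) by (auto simp: vanishing_mult_def)
qed

text \<open>
  Converse of \<open>vanishing_mult_le_of_factor\<close>. If \<open>f\<close> vanishes identically, \<open>k = 0\<close> works; otherwise
  both multiplicities at a zero of \<open>B\<close> are finite and equal the orders of vanishing.
\<close>
lemma factor_of_vanishing_mult_le:
  assumes B: "B holomorphic_on unit_disk" "\<exists>z\<in>unit_disk. B z \<noteq> 0" and f: "f holomorphic_on unit_disk"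
    and le: "\<And>w. w \<in> zero_set B \<Longrightarrow> vanishing_mult B w \<le> vanishing_mult f w"
  obtains k where "k holomorphic_on unit_disk" "\<And>z. z \<in> unit_disk \<Longrightarrow> f z = B z * k z"
proof (cases "\<exists>z\<in>unit_disk. f z \<noteq> 0")
  case False
  then show ?thesis by (intro that[of "\<lambda>_. 0"]) auto
next
  case True
  show ?thesis
  proof (rule holomorphic_divide_zorder[OF open_ball connected_ball f True B])
    fix w assume w: "w \<in> unit_disk" "B w = 0"
    have "vanishing_mult B w = enat (nat (zorder B w))"
      using w B(2) by (auto simp: vanishing_mult_def)
    moreover have pos: "0 < zorder B w" by (rule zorder_pos_at_zero[OF B w])
    ultimately have le': "enat (nat (zorder B w)) \<le> vanishing_mult f w" using le[of w] w by (simp add: zero_set_def)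
    then have "f w = 0" using pos by (auto simp: vanishing_mult_def zero_enat_def split: if_splits)
    then have "vanishing_mult f w = enat (nat (zorder f w))"
      using True by (auto simp: vanishing_mult_def)
    then show "zorder B w \<le> zorder f w" using le' pos by simp
  qed (rule that)
qed

lemma hardy_space_cong:
  assumes "\<And>z. z \<in> unit_disk \<Longrightarrow> f z = g z"
  shows "f \<in> hardy_space p \<longleftrightarrow> g \<in> hardy_space p"
proof -
  have "power_mean_integral p f r = power_mean_integral p g r" if "r \<in> {0<..<1}" for r
    using assms that by (simp add: power_mean_integral_def)
  moreover have "f holomorphic_on unit_disk \<longleftrightarrow> g holomorphic_on unit_disk"
    using assms by (intro holomorphic_cong) auto
  ultimately show ?thesis unfolding hardy_space_iff by simp
qed

theorem theorem3p13:
  fixes p :: real and \<phi> B :: "complex \<Rightarrow> complex"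
  assumes "0 < p"
    and "\<phi> holomorphic_on unit_disk" and "\<phi> ` unit_disk \<subseteq> unit_disk"
    and "blaschke_product B"
  shows "inner_comp_class p B \<phi> =
    {\<theta>. \<exists>B1 S. blaschke_product B1 \<and> singular_inner S \<and>
       (\<forall>w\<in>zero_set B. vanishing_mult B w \<le> vanishing_mult (B1 \<circ> \<phi>) w) \<and>
       (\<forall>z\<in>unit_disk. \<theta> z = B1 z * S z)}"
proof (intro set_eqI iffI)
  have B: "B holomorphic_on unit_disk" "\<exists>z\<in>unit_disk. B z \<noteq> 0"
    using assms(4) by (rule blaschke_product_holomorphic, rule blaschke_product_nonzero)
  have \<phi>_in: "\<phi> z \<in> unit_disk" if "z \<in> unit_disk" for z using assms(3) that by blast
  have comp: "(\<lambda>z. f (\<phi> z)) holomorphic_on unit_disk" if "f holomorphic_on unit_disk" for f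
    using holomorphic_on_compose_gen[OF assms(2) that assms(3)] by (simp add: o_def)
  {
    fix \<theta> assume "\<theta> \<in> inner_comp_class p B \<phi>"
    then have \<theta>: "inner_function \<theta>"
      and sub: "comp_op \<phi> ` mult_space \<theta> (hardy_space p) \<subseteq> mult_space B (hardy_space p)"
      by (auto simp: inner_comp_class_def)
    \<comment> \<open>The inclusion is tested on the constant function 1.\<close>
    have "\<theta> \<in> mult_space \<theta> (hardy_space p)"
      unfolding mult_space_def using one_in_hardy_space[OF assms(1)] by (intro CollectI bexI[of _ "\<lambda>_. 1"]) auto
    then have "comp_op \<phi> \<theta> \<in> mult_space B (hardy_space p)" using sub by blast
    then obtain g where "g \<in> hardy_space p" and g: "\<And>z. z \<in> unit_disk \<Longrightarrow> \<theta> (\<phi> z) = B z * g z"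
      by (auto simp: mult_space_def comp_op_def)
    then have g_holo: "g holomorphic_on unit_disk" by (simp add: hardy_space_iff)
    obtain B1 S where B1: "blaschke_product B1" and S: "singular_inner S"
      and eq: "\<And>z. z \<in> unit_disk \<Longrightarrow> \<theta> z = B1 z * S z"
      using inner_function_factorization[OF \<theta>] by blast
    have S': "S holomorphic_on unit_disk" "\<And>z. z \<in> unit_disk \<Longrightarrow> S z \<noteq> 0"
      using S by (auto simp: singular_inner_def inner_function_def)
    have k: "(\<lambda>z. g z / S (\<phi> z)) holomorphic_on unit_disk"
      by (intro holomorphic_intros g_holo comp S' \<phi>_in)
    have "(B1 \<circ> \<phi>) z = B z * (g z / S (\<phi> z))" if "z \<in> unit_disk" for z
      using g[OF that] eq[OF \<phi>_in[OF that]] S'(2)[OF \<phi>_in[OF that]] by (simp add: field_simps)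
    then have "\<forall>w\<in>zero_set B. vanishing_mult B w \<le> vanishing_mult (B1 \<circ> \<phi>) w"
      using vanishing_mult_le_of_factor[OF B k] by (simp add: zero_set_def)
    then show "\<theta> \<in> {\<theta>. \<exists>B1 S. blaschke_product B1 \<and> singular_inner S \<and>
       (\<forall>w\<in>zero_set B. vanishing_mult B w \<le> vanishing_mult (B1 \<circ> \<phi>) w) \<and>
       (\<forall>z\<in>unit_disk. \<theta> z = B1 z * S z)}" using B1 S eq by blast
  next
    fix \<theta> assume "\<theta> \<in> {\<theta>. \<exists>B1 S. blaschke_product B1 \<and> singular_inner S \<and>
       (\<forall>w\<in>zero_set B. vanishing_mult B w \<le> vanishing_mult (B1 \<circ> \<phi>) w) \<and>
       (\<forall>z\<in>unit_disk. \<theta> z = B1 z * S z)}"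
    then obtain B1 S where B1: "blaschke_product B1" and S: "singular_inner S"
      and le: "\<And>w. w \<in> zero_set B \<Longrightarrow> vanishing_mult B w \<le> vanishing_mult (B1 \<circ> \<phi>) w"
      and eq: "\<And>z. z \<in> unit_disk \<Longrightarrow> \<theta> z = B1 z * S z" by blast
    have \<theta>: "inner_function \<theta>"
      by (rule inner_function_mult[OF blaschke_product_inner[OF B1] _ eq]) (use S in \<open>auto simp: singular_inner_def\<close>)
    then have \<theta>_holo: "\<theta> holomorphic_on unit_disk" by (simp add: inner_function_def)
    obtain C where C: "\<And>z. z \<in> unit_disk \<Longrightarrow> norm (\<theta> z) \<le> C"
      using \<theta> unfolding inner_function_def bounded_iff by blast
    have S_holo: "S holomorphic_on unit_disk" using S by (simp add: singular_inner_def inner_function_def)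
    have "B1 \<circ> \<phi> holomorphic_on unit_disk"
      using comp[OF blaschke_product_holomorphic[OF B1]] by (simp add: o_def)
    from factor_of_vanishing_mult_le[OF B this le] obtain k
      where k: "k holomorphic_on unit_disk" "\<And>z. z \<in> unit_disk \<Longrightarrow> (B1 \<circ> \<phi>) z = B z * k z"
      by metis
    have "comp_op \<phi> u \<in> mult_space B (hardy_space p)" if u: "u \<in> mult_space \<theta> (hardy_space p)" for u
    proof -
      obtain f where f: "f \<in> hardy_space p" "\<And>z. z \<in> unit_disk \<Longrightarrow> u z = \<theta> z * f z"
        using u by (auto simp: mult_space_def)
      have f_holo: "f holomorphic_on unit_disk" using f(1) by (simp add: hardy_space_iff)
      define q where "q z = k z * (S (\<phi> z) * f (\<phi> z))" for z
      have q: "q holomorphic_on unit_disk"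
        unfolding q_def by (intro holomorphic_intros k comp S_holo f_holo)
      have eq_u: "u (\<phi> z) = B z * q z" if "z \<in> unit_disk" for z
        using f(2)[OF \<phi>_in[OF that]] eq[OF \<phi>_in[OF that]] k(2)[OF that] by (simp add: q_def)
      have "(\<lambda>z. \<theta> z * f z) \<circ> \<phi> \<in> hardy_space p"
        by (intro hardy_space_comp hardy_space_bounded_mult[OF f(1) assms(1) \<theta>_holo C] assms)
      then have "(\<lambda>z. B z * q z) \<in> hardy_space p"
        using hardy_space_cong[of "(\<lambda>z. \<theta> z * f z) \<circ> \<phi>" "\<lambda>z. B z * q z" p] eq_u f(2) \<phi>_in by simp
      then have "q \<in> hardy_space p" by (rule hardy_space_divide_blaschke[OF assms(4) q assms(1)])
      then show ?thesis using eq_u by (auto simp: mult_space_def comp_op_def)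
    qed
    then show "\<theta> \<in> inner_comp_class p B \<phi>" using \<theta> by (auto simp: inner_comp_class_def)
  }
qed

end
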